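(* Let $P$ be a finite point configuration in the plane, $P_0\subseteq P$, and $d=|P\setminus P_0|$. (a) There is an absolute constant $C$ such that whenever all points of $P_0$ are collinear, the clique-width of $P$ is at most $C\cdot(d+1)$ (i.e., it is in $O(d)$). (b) There is an absolute constant $C'$ such that whenever the points of $P_0$ are in strictly convex position and $d\le 1$, the clique-width of $P$ is at most $C'$. On the other hand, there exist configurations $P$ with $P_0$ in strictly convex position and $d=2$ of arbitrarily large clique-width (i.e., the clique-width of such configurations is unbounded).
   Context: For a finite point set $P$ in the plane, its order type is the ternary relation $\Omega(P)\subseteq P^3$ with $(a,b,c)\in\Omega(P)$ iff $a,b,c$ are distinct and the triangle $abc$ is oriented counter-clockwise. The cyclic closure of $(a,b,c)$ is $\{(a,b,c),(b,c,a),(c,a,b)\}$. Strictly convex position means every point of $P_0$ is a vertex of the convex hull of $P_0$. Clique-width: an expression uses unary labels (on points) and binary labels (on ordered pairs of points) and the operations (w1) create a new point with a single unary label $i$; (w2) disjoint union of two labelled structures; (w3) for all points $a$ of unary label $i$ and $b$ of unary label $j$ ($i\neq j$), give the ordered pair $(a,b)$ binary label $k$ (pairs may carry several labels); (w4) for all pairwise distinct $a,b,c$ with $c$ of unary label $i$ and $(a,b)$ of binary label $k$, add the cyclic closure of $(a,b,c)$ to the ternary relation; (w4') under the same conditions add the cyclic closure of $(b,a,c)$; (w5) relabel all tuples (points or pairs) of label $i$ to label $j$ of the same arity. The value of the expression is the ternary structure on the created points consisting of the triples added by (w4),(w4'). The width of an expression is the sum of the arities of the labels occurring in it, and the clique-width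 of $P$ is the least width of an expression whose value is $\Omega(P)$. *)

theory Defs
  imports "HOL-Analysis.Analysis" "HOL-Library.Extended_Nat"
begin

definition ccw_triangle :: "real ^ 2 \<Rightarrow> real ^ 2 \<Rightarrow> real ^ 2 \<Rightarrow> bool" where
  "ccw_triangle a b c \<longleftrightarrow> det (vector [b - a, c - a] :: real ^ 2 ^ 2) > 0"

definition order_type :: "(real ^ 2) set \<Rightarrow> ((real ^ 2) \<times> (real ^ 2) \<times> (real ^ 2)) set" where
  "order_type P = {(a, b, c). a \<in> P \<and> b \<in> P \<and> c \<in> P \<and> distinct [a, b, c] \<and> ccw_triangle a b c}"

definition strictly_convex_position :: "(real ^ 2) set \<Rightarrow> bool" where
  "strictly_convex_position S \<longleftrightarrow> (\<forall>p\<in>S. p extreme_point_of (convex hull S))"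

definition cyclic_closure :: "'p \<times> 'p \<times> 'p \<Rightarrow> ('p \<times> 'p \<times> 'p) set" where
  "cyclic_closure = (\<lambda>(a, b, c). {(a, b, c), (b, c, a), (c, a, b)})"

text \<open>
  Each created point is named by the element of the universe it stands for, so that the value
  of an expression can be compared with a given structure by equality instead of isomorphism.
  The three set functions of the datatype yield the created points, the unary labels and the
  binary labels occurring in an expression (in any operation).
\<close>

datatype (points: 'p, unary_labels: 'u, binary_labels: 'b) cw_expr =
  New_Point 'p 'u
| Disjoint_Union "('p, 'u, 'b) cw_expr" "('p, 'u, 'b) cw_expr"
| Label_Pairs 'u 'u 'b "('p, 'u, 'b) cw_expr"
| Add_Triples 'u 'b "('p, 'u, 'b) cw_expr"
| Add_Reversed_Triples 'u 'b "('p, 'u, 'b) cw_expr"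
| Relabel_Unary 'u 'u "('p, 'u, 'b) cw_expr"
| Relabel_Binary 'b 'b "('p, 'u, 'b) cw_expr"

primrec valid_expr :: "('p, 'u, 'b) cw_expr \<Rightarrow> bool" where
  "valid_expr (New_Point p i) \<longleftrightarrow> True"
| "valid_expr (Disjoint_Union e f) \<longleftrightarrow>
     valid_expr e \<and> valid_expr f \<and> points e \<inter> points f = {}"
| "valid_expr (Label_Pairs i j k e) \<longleftrightarrow> i \<noteq> j \<and> valid_expr e"
| "valid_expr (Add_Triples i k e) \<longleftrightarrow> valid_expr e"
| "valid_expr (Add_Reversed_Triples i k e) \<longleftrightarrow> valid_expr e"
| "valid_expr (Relabel_Unary i j e) \<longleftrightarrow> valid_expr e"
| "valid_expr (Relabel_Binary i j e) \<longleftrightarrow> valid_expr e"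

primrec point_labelling :: "('p, 'u, 'b) cw_expr \<Rightarrow> ('p \<times> 'u) set" where
  "point_labelling (New_Point p i) = {(p, i)}"
| "point_labelling (Disjoint_Union e f) = point_labelling e \<union> point_labelling f"
| "point_labelling (Label_Pairs i j k e) = point_labelling e"
| "point_labelling (Add_Triples i k e) = point_labelling e"
| "point_labelling (Add_Reversed_Triples i k e) = point_labelling e"
| "point_labelling (Relabel_Unary i j e) =
     {(p, if l = i then j else l) | p l. (p, l) \<in> point_labelling e}"
| "point_labelling (Relabel_Binary i j e) = point_labelling e"

primrec pair_labelling :: "('p, 'u, 'b) cw_expr \<Rightarrow> (('p \<times> 'p) \<times> 'b) set" where
  "pair_labelling (New_Point p i) = {}"
| "pair_labelling (Disjoint_Union e f) = pair_labelling e \<union> pair_labelling f"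
| "pair_labelling (Label_Pairs i j k e) = pair_labelling e \<union>
     {((a, b), k) | a b. (a, i) \<in> point_labelling e \<and> (b, j) \<in> point_labelling e}"
| "pair_labelling (Add_Triples i k e) = pair_labelling e"
| "pair_labelling (Add_Reversed_Triples i k e) = pair_labelling e"
| "pair_labelling (Relabel_Unary i j e) = pair_labelling e"
| "pair_labelling (Relabel_Binary i j e) =
     {(q, if l = i then j else l) | q l. (q, l) \<in> pair_labelling e}"

primrec triples :: "('p, 'u, 'b) cw_expr \<Rightarrow> ('p \<times> 'p \<times> 'p) set" where
  "triples (New_Point p i) = {}"
| "triples (Disjoint_Union e f) = triples e \<union> triples f"
| "triples (Label_Pairs i j k e) = triples e"
| "triples (Add_Triples i k e) = triples e \<union>
     \<Union>{cyclic_closure (a, b, c) | a b c. distinct [a, b, c] \<and>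
         (c, i) \<in> point_labelling e \<and> ((a, b), k) \<in> pair_labelling e}"
| "triples (Add_Reversed_Triples i k e) = triples e \<union>
     \<Union>{cyclic_closure (b, a, c) | a b c. distinct [a, b, c] \<and>
         (c, i) \<in> point_labelling e \<and> ((a, b), k) \<in> pair_labelling e}"
| "triples (Relabel_Unary i j e) = triples e"
| "triples (Relabel_Binary i j e) = triples e"

definition width :: "('p, 'u, 'b) cw_expr \<Rightarrow> nat" where
  "width e = card (unary_labels e) + 2 * card (binary_labels e)"

text \<open>
  Every expression creates at least one point, so the empty structure is not the value of any
  expression; its clique-width is set to 0 by convention. Otherwise the infimum is attained
  unless the structure has no expression at all (and then the value is \<open>\<infinity>\<close>).
\<close>

definition structure_clique_width :: "'p set \<Rightarrow> ('p \<times> 'p \<times> 'p) set \<Rightarrow> enat" where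
  "structure_clique_width A R =
     (if A = {} then 0
      else INF e\<in>{e :: ('p, nat, nat) cw_expr. valid_expr e \<and> points e = A \<and> triples e = R}.
             enat (width e))"

definition clique_width :: "(real ^ 2) set \<Rightarrow> enat" where
  "clique_width P = structure_clique_width P (order_type P)"

end

theory Submission
  imports Defs
begin

text \<open>
  Upper bounds. Points are created one at a time. In (a) each of the \<open>d\<close> points off the line keeps
  a unary label of its own, so that every triple with at most two points on the line can be added
  individually when its last point is created; the points on the line are created from left to
  right. In (b) let \<open>x\<close> be the point outside \<open>P0\<close> and sort \<open>P0\<close> by direction as seen from \<open>x\<close>,
  opposite directions being identified. The order of three points of \<open>P0\<close>, the rays on which
  they lie, and the information whether the hull is entered or left in them determine the
  orientation of the triple: either \<open>x\<close> lies in the triangle, or one of the points is seen from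
  \<open>x\<close> between the other two, before or behind their segment.

  Lower bound. Take points \<open>l s\<close> and \<open>u s\<close>, \<open>s < m\<^sup>2\<close>, on two slightly curved opposite chains, and
  two points \<open>x\<close> and \<open>y\<close> such that \<open>l s\<close> is next to \<open>u s\<close> in the angular order around \<open>x\<close>, whereas
  \<open>l (s + m)\<close> is next to \<open>u s\<close> around \<open>y\<close>. A subexpression creating a set \<open>A\<close> of points can only
  distinguish boundedly many kinds of points of \<open>A\<close> from the outside, so \<open>A\<close> changes boundedly often
  along each angular order. Hence on \<open>{..<m\<^sup>2}\<close>, seen as a square grid of side \<open>m\<close>, the set of all
  \<open>s\<close> with \<open>l s \<in> A\<close> changes boundedly often along rows and columns and is almost empty or almost
  everything. But some subexpression creates a medium number of the points \<open>l s\<close>.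
\<close>

section \<open>Realizing ternary structures with given labels\<close>

definition triples_of :: "('p \<Rightarrow> 'p \<Rightarrow> 'p \<Rightarrow> bool) \<Rightarrow> 'p set \<Rightarrow> ('p \<times> 'p \<times> 'p) set" where
  "triples_of T A = {(a, b, c). a \<in> A \<and> b \<in> A \<and> c \<in> A \<and> distinct [a, b, c] \<and> T a b c}"

lemma triples_of_empty [simp]: "triples_of T {} = {}"
  by (simp add: triples_of_def)

text \<open>Since \<open>T\<close> is invariant under rotation, every triple through
  \<open>v\<close> can be turned so that \<open>v\<close> comes last. When points are created one by
  one, only these triples have to be added at each step.\<close>

lemma triples_of_insert:
  assumes "\<And>a b c. T a b c \<longleftrightarrow> T b c a" and "v \<notin> A"
  shows "triples_of T (insert v A) = triples_of T A \<union>
    \<Union>{cyclic_closure (a, b, v) | a b. a \<in> A \<and> b \<in> A \<and> a \<noteq> b \<and> T a b v}" (is "?L = ?R")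
proof
  show "?L \<subseteq> ?R"
  proof
    fix t assume t: "t \<in> ?L"
    obtain a b c where [simp]: "t = (a, b, c)" by (metis prod_cases3)
    have abc: "a \<in> insert v A" "b \<in> insert v A" "c \<in> insert v A" "a \<noteq> b" "b \<noteq> c" "a \<noteq> c" "T a b c"
      using t by (auto simp: triples_of_def)
    have T: "T b c a" "T c a b" using abc(7) assms(1) by blast+
    consider "a \<noteq> v" "b \<noteq> v" "c \<noteq> v" | "a = v" | "b = v" | "c = v" by blast
    then show "t \<in> ?R"
    proof cases
      case 1 then show ?thesis using abc by (auto simp: triples_of_def)
    next
      case 2
      then have "t \<in> cyclic_closure (b, c, v)" by (simp add: cyclic_closure_def)
      then show ?thesis using abc T 2 by blast
    next
      case 3
      then have "t \<in> cyclic_closure (c, a, v)" by (simp add: cyclic_closure_def)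
      then show ?thesis using abc T 3 by blast
    next
      case 4
      then have "t \<in> cyclic_closure (a, b, v)" by (simp add: cyclic_closure_def)
      then show ?thesis using abc T 4 by blast
    qed
  qed
  have "\<And>a b c. T a b c \<Longrightarrow> T b c a" using assms(1) by blast
  then show "?R \<subseteq> ?L"
    using assms(2) by (fastforce simp: triples_of_def cyclic_closure_def)
qed

text \<open>The empty structure is admitted, although no expression has it as its value, so that
  structures can be built up from nothing.\<close>

definition realizes ::
  "'u set \<Rightarrow> 'b set \<Rightarrow> 'p set \<Rightarrow> ('p \<Rightarrow> 'u) \<Rightarrow> (('p \<times> 'p) \<times> 'b) set \<Rightarrow> ('p \<times> 'p \<times> 'p) set \<Rightarrow> bool"
where
  "realizes U B A lab M R \<longleftrightarrow> (A = {} \<and> M = {} \<and> R = {}) \<or>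
     (\<exists>e :: ('p, 'u, 'b) cw_expr. valid_expr e \<and> points e = A \<and> unary_labels e \<subseteq> U \<and>
        binary_labels e \<subseteq> B \<and> point_labelling e = (\<lambda>p. (p, lab p)) ` A \<and>
        pair_labelling e = M \<and> triples e = R)"

lemma realizes_empty: "realizes U B {} lab {} {}"
  by (simp add: realizes_def)

lemma realizes_cong:
  assumes "realizes U B A lab M R" "\<And>p. p \<in> A \<Longrightarrow> lab p = lab' p" "M = M'" "R = R'"
  shows "realizes U B A lab' M' R'"
proof -
  have "(\<lambda>p. (p, lab p)) ` A = (\<lambda>p. (p, lab' p)) ` A" using assms(2) by (intro image_cong) auto
  then show ?thesis using assms(1,3,4) by (simp add: realizes_def)
qed

lemma realizes_insert:
  assumes "realizes U B A lab M R" "p \<notin> A" "u \<in> U"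
  shows "realizes U B (insert p A) (lab(p := u)) M R"
proof (cases "A = {} \<and> M = {} \<and> R = {}")
  case True
  then show ?thesis using assms(3) unfolding realizes_def
    by (intro disjI2 exI[of _ "New_Point p u"]) auto
next
  case False
  then obtain e :: "('c, 'a, 'b) cw_expr" where e: "valid_expr e" "points e = A"
    "unary_labels e \<subseteq> U" "binary_labels e \<subseteq> B" "point_labelling e = (\<lambda>p. (p, lab p)) ` A"
    "pair_labelling e = M" "triples e = R"
    using assms(1) unfolding realizes_def by blast
  show ?thesis using assms(2,3) e unfolding realizes_def
    by (intro disjI2 exI[of _ "Disjoint_Union e (New_Point p u)"]) auto
qed

lemma realizes_label_pairs:
  assumes "realizes U B A lab M R" "i \<in> U" "j \<in> U" "i \<noteq> j" "k \<in> B"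
  shows "realizes U B A lab (M \<union> {((a, b), k) | a b. a \<in> A \<and> b \<in> A \<and> lab a = i \<and> lab b = j}) R"
proof (cases "A = {} \<and> M = {} \<and> R = {}")
  case False
  then obtain e :: "('c, 'a, 'b) cw_expr" where e: "valid_expr e" "points e = A"
    "unary_labels e \<subseteq> U" "binary_labels e \<subseteq> B" "point_labelling e = (\<lambda>p. (p, lab p)) ` A"
    "pair_labelling e = M" "triples e = R"
    using assms(1) unfolding realizes_def by blast
  show ?thesis using assms(2-) e unfolding realizes_def
    by (intro disjI2 exI[of _ "Label_Pairs i j k e"]) auto
qed (simp add: realizes_def)

lemma realizes_add_triples:
  assumes "realizes U B A lab M R" "i \<in> U" "k \<in> B"
  shows "realizes U B A lab M (R \<union> \<Union>{cyclic_closure (a, b, c) | a b c. distinct [a, b, c] \<and>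
    c \<in> A \<and> lab c = i \<and> ((a, b), k) \<in> M})"
proof (cases "A = {} \<and> M = {} \<and> R = {}")
  case False
  then obtain e :: "('c, 'a, 'b) cw_expr" where e: "valid_expr e" "points e = A"
    "unary_labels e \<subseteq> U" "binary_labels e \<subseteq> B" "point_labelling e = (\<lambda>p. (p, lab p)) ` A"
    "pair_labelling e = M" "triples e = R"
    using assms(1) unfolding realizes_def by blast
  have *: "(c, i) \<in> (\<lambda>p. (p, lab p)) ` A \<longleftrightarrow> c \<in> A \<and> lab c = i" for c by auto
  show ?thesis using assms(2-) e unfolding realizes_def
    by (intro disjI2 exI[of _ "Add_Triples i k e"]) (simp add: * conj_assoc)
qed (simp add: realizes_def)

lemma realizes_add_reversed_triples:
  assumes "realizes U B A lab M R" "i \<in> U" "k \<in> B"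
  shows "realizes U B A lab M (R \<union> \<Union>{cyclic_closure (b, a, c) | a b c. distinct [a, b, c] \<and>
    c \<in> A \<and> lab c = i \<and> ((a, b), k) \<in> M})"
proof (cases "A = {} \<and> M = {} \<and> R = {}")
  case False
  then obtain e :: "('c, 'a, 'b) cw_expr" where e: "valid_expr e" "points e = A"
    "unary_labels e \<subseteq> U" "binary_labels e \<subseteq> B" "point_labelling e = (\<lambda>p. (p, lab p)) ` A"
    "pair_labelling e = M" "triples e = R"
    using assms(1) unfolding realizes_def by blast
  have *: "(c, i) \<in> (\<lambda>p. (p, lab p)) ` A \<longleftrightarrow> c \<in> A \<and> lab c = i" for c by auto
  show ?thesis using assms(2-) e unfolding realizes_def
    by (intro disjI2 exI[of _ "Add_Reversed_Triples i k e"]) (simp add: * conj_assoc)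
qed (simp add: realizes_def)

lemma realizes_relabel_unary:
  assumes "realizes U B A lab M R" "i \<in> U" "j \<in> U"
  shows "realizes U B A (\<lambda>p. if lab p = i then j else lab p) M R"
proof (cases "A = {} \<and> M = {} \<and> R = {}")
  case False
  then obtain e :: "('c, 'a, 'b) cw_expr" where e: "valid_expr e" "points e = A"
    "unary_labels e \<subseteq> U" "binary_labels e \<subseteq> B" "point_labelling e = (\<lambda>p. (p, lab p)) ` A"
    "pair_labelling e = M" "triples e = R"
    using assms(1) unfolding realizes_def by blast
  show ?thesis using assms(2-) e unfolding realizes_def
    by (intro disjI2 exI[of _ "Relabel_Unary i j e"]) (auto simp: image_iff)
qed (simp add: realizes_def)

lemma realizes_relabel_binary:
  assumes "realizes U B A lab M R" "i \<in> B" "j \<in> B"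
  shows "realizes U B A lab {(q, if l = i then j else l) | q l. (q, l) \<in> M} R"
proof (cases "A = {} \<and> M = {} \<and> R = {}")
  case False
  then obtain e :: "('c, 'a, 'b) cw_expr" where e: "valid_expr e" "points e = A"
    "unary_labels e \<subseteq> U" "binary_labels e \<subseteq> B" "point_labelling e = (\<lambda>p. (p, lab p)) ` A"
    "pair_labelling e = M" "triples e = R"
    using assms(1) unfolding realizes_def by blast
  show ?thesis using assms(2-) e unfolding realizes_def
    by (intro disjI2 exI[of _ "Relabel_Binary i j e"]) auto
qed (simp add: realizes_def)

section \<open>Injective renaming of labels\<close>

lemma labels_of_labelling:
  "(p, l) \<in> point_labelling e \<Longrightarrow> p \<in> points e \<and> l \<in> unary_labels e"
  by (induction e arbitrary: p l) (auto split: if_splits)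

lemma labels_of_pair_labelling:
  "((a, b), k) \<in> pair_labelling e \<Longrightarrow> a \<in> points e \<and> b \<in> points e \<and> k \<in> binary_labels e"
  by (induction e arbitrary: a b k) (auto dest: labels_of_labelling split: if_splits)

text \<open>A relabelling tests labels for equality; injectivity of \<open>f\<close> on the
  occurring labels keeps the renaming from creating new coincidences.\<close>

lemma point_labelling_map_expr:
  assumes "inj_on f (unary_labels e)"
  shows "point_labelling (map_cw_expr (\<lambda>p. p) f g e) = {(p, f l) | p l. (p, l) \<in> point_labelling e}"
  using assms
proof (induction e)
  case (Relabel_Unary i j e)
  then have IH: "point_labelling (map_cw_expr (\<lambda>p. p) f g e) = {(p, f l) | p l. (p, l) \<in> point_labelling e}"
    by (auto intro: inj_on_subset)
  have eq: "f l = f i \<longleftrightarrow> l = i" if "(p, l) \<in> point_labelling e" for p l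
    using labels_of_labelling[OF that] by (intro inj_on_eq_iff[OF Relabel_Unary.prems]) auto
  have "point_labelling (map_cw_expr (\<lambda>p. p) f g (Relabel_Unary i j e)) =
    {(p, if f l = f i then f j else f l) | p l. (p, l) \<in> point_labelling e}"
    by (simp only: cw_expr.map point_labelling.simps IH) blast
  also have "\<dots> = {(p, f (if l = i then j else l)) | p l. (p, l) \<in> point_labelling e}"
    by (intro Collect_cong ex_cong1) (simp add: eq cong: rev_conj_cong)
  also have "\<dots> = {(p, f l) | p l. (p, l) \<in> point_labelling (Relabel_Unary i j e)}"
    by auto
  finally show ?case .
qed (auto simp: inj_on_Un)

lemma point_labelling_map_expr_iff:
  assumes "inj_on f (unary_labels e)" "i \<in> unary_labels e"
  shows "(p, f i) \<in> point_labelling (map_cw_expr (\<lambda>p. p) f g e) \<longleftrightarrow> (p, i) \<in> point_labelling e"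
  using assms labels_of_labelling[of p _ e]
  by (auto simp: point_labelling_map_expr dest: inj_onD)

lemma pair_labelling_map_expr:
  assumes "inj_on f (unary_labels e)" "inj_on g (binary_labels e)"
  shows "pair_labelling (map_cw_expr (\<lambda>p. p) f g e) = {(q, g k) | q k. (q, k) \<in> pair_labelling e}"
  using assms
proof (induction e)
  case (Label_Pairs i j k e)
  then have inj: "inj_on f (unary_labels e)" "inj_on g (binary_labels e)"
    by (auto intro: inj_on_subset)
  have pl: "(p, f l) \<in> point_labelling (map_cw_expr (\<lambda>p. p) f g e) \<longleftrightarrow> (p, l) \<in> point_labelling e"
    if "l \<in> {i, j}" for p l
  proof -
    have "(p, f l) \<in> point_labelling (map_cw_expr (\<lambda>p. p) f g (Label_Pairs i j k e)) \<longleftrightarrow>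
      (p, l) \<in> point_labelling (Label_Pairs i j k e)"
      using that Label_Pairs.prems(1) by (intro point_labelling_map_expr_iff) auto
    then show ?thesis by simp
  qed
  show ?case by (auto simp: Label_Pairs.IH[OF inj] pl)
next
  case (Relabel_Binary i j e)
  then have IH: "pair_labelling (map_cw_expr (\<lambda>p. p) f g e) = {(q, g k) | q k. (q, k) \<in> pair_labelling e}"
    by (auto intro: inj_on_subset)
  have eq: "g k = g i \<longleftrightarrow> k = i" if "(q, k) \<in> pair_labelling e" for q k
    using labels_of_pair_labelling[of "fst q" "snd q" k e] that
    by (intro inj_on_eq_iff[OF Relabel_Binary.prems(2)]) auto
  have "pair_labelling (map_cw_expr (\<lambda>p. p) f g (Relabel_Binary i j e)) =
    {(q, if g k = g i then g j else g k) | q k. (q, k) \<in> pair_labelling e}"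
    by (simp only: cw_expr.map pair_labelling.simps IH) blast
  also have "\<dots> = {(q, g (if k = i then j else k)) | q k. (q, k) \<in> pair_labelling e}"
    by (intro Collect_cong ex_cong1) (simp add: eq cong: rev_conj_cong)
  also have "\<dots> = {(q, g k) | q k. (q, k) \<in> pair_labelling (Relabel_Binary i j e)}"
    by auto
  finally show ?case .
qed (auto simp: inj_on_Un)

lemma pair_labelling_map_expr_iff:
  assumes "inj_on f (unary_labels e)" "inj_on g (binary_labels e)" "k \<in> binary_labels e"
  shows "((a, b), g k) \<in> pair_labelling (map_cw_expr (\<lambda>p. p) f g e) \<longleftrightarrow> ((a, b), k) \<in> pair_labelling e"
  using assms labels_of_pair_labelling[of a b _ e]
  by (auto simp: pair_labelling_map_expr dest: inj_onD)

text \<open>Triples consist of points only, and each label test that leads to a triple has the same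
  outcome after an injective renaming.\<close>

lemma triples_map_expr:
  assumes "inj_on f (unary_labels e)" "inj_on g (binary_labels e)"
  shows "triples (map_cw_expr (\<lambda>p. p) f g e) = triples e"
  using assms
proof (induction e)
  case (Add_Triples i k e)
  have "(p, f i) \<in> point_labelling (map_cw_expr (\<lambda>p. p) f g e) \<longleftrightarrow> (p, i) \<in> point_labelling e"
    "((a, b), g k) \<in> pair_labelling (map_cw_expr (\<lambda>p. p) f g e) \<longleftrightarrow> ((a, b), k) \<in> pair_labelling e"
    for p a b
    using point_labelling_map_expr_iff[OF Add_Triples.prems(1), of i p g]
      pair_labelling_map_expr_iff[OF Add_Triples.prems, of k a b] by auto
  with Add_Triples show ?case by auto
next
  case (Add_Reversed_Triples i k e)
  have "(p, f i) \<in> point_labelling (map_cw_expr (\<lambda>p. p) f g e) \<longleftrightarrow> (p, i) \<in> point_labelling e"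
    "((a, b), g k) \<in> pair_labelling (map_cw_expr (\<lambda>p. p) f g e) \<longleftrightarrow> ((a, b), k) \<in> pair_labelling e"
    for p a b
    using point_labelling_map_expr_iff[OF Add_Reversed_Triples.prems(1), of i p g]
      pair_labelling_map_expr_iff[OF Add_Reversed_Triples.prems, of k a b] by auto
  with Add_Reversed_Triples show ?case by auto
qed (auto simp: inj_on_Un)

lemma valid_map_expr:
  assumes "inj_on f (unary_labels e)"
  shows "valid_expr (map_cw_expr (\<lambda>p. p) f g e) \<longleftrightarrow> valid_expr e"
  using assms
proof (induction e)
  case (Disjoint_Union e e')
  then show ?case by (simp add: cw_expr.set_map inj_on_Un)
next
  case (Label_Pairs i j k e)
  have "f i = f j \<longleftrightarrow> i = j" by (intro inj_on_eq_iff[OF Label_Pairs.prems]) auto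
  moreover have "inj_on f (unary_labels e)" by (rule inj_on_subset[OF Label_Pairs.prems]) auto
  ultimately show ?case using Label_Pairs.IH by simp
next
  case (Relabel_Unary i j e)
  have "inj_on f (unary_labels e)" by (rule inj_on_subset[OF Relabel_Unary.prems]) auto
  then show ?case using Relabel_Unary.IH by simp
next
  case (Add_Triples i k e)
  have "inj_on f (unary_labels e)" by (rule inj_on_subset[OF Add_Triples.prems]) auto
  then show ?case using Add_Triples.IH by simp
next
  case (Add_Reversed_Triples i k e)
  have "inj_on f (unary_labels e)" by (rule inj_on_subset[OF Add_Reversed_Triples.prems]) auto
  then show ?case using Add_Reversed_Triples.IH by simp
qed simp_all

text \<open>This lets the upper bounds use any convenient finite label types: the labels are sent
  injectively to natural numbers. The empty case of \<open>realizes\<close> agrees with the value 0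
  given to the empty structure.\<close>

lemma structure_clique_width_le:
  fixes U :: "'u set" and B :: "'b set"
  assumes "realizes U B A lab M R" "finite U" "finite B"
  shows "structure_clique_width A R \<le> enat (card U + 2 * card B)"
proof (cases "A = {}")
  case False
  then obtain e :: "('a, 'u, 'b) cw_expr" where e: "valid_expr e" "points e = A"
    "unary_labels e \<subseteq> U" "binary_labels e \<subseteq> B" "triples e = R"
    using assms(1) unfolding realizes_def by blast
  obtain f :: "'u \<Rightarrow> nat" where f: "inj_on f U" using finite_imp_inj_to_nat_seg assms(2) by metis
  obtain g :: "'b \<Rightarrow> nat" where g: "inj_on g B" using finite_imp_inj_to_nat_seg assms(3) by metis
  define e' where "e' = map_cw_expr (\<lambda>p. p) f g e"
  have inj: "inj_on f (unary_labels e)" "inj_on g (binary_labels e)"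
    by (rule inj_on_subset[OF f e(3)], rule inj_on_subset[OF g e(4)])
  have "valid_expr e'" "points e' = A" "triples e' = R"
    using e inj by (simp_all add: e'_def valid_map_expr triples_map_expr cw_expr.set_map)
  then have "structure_clique_width A R \<le> enat (width e')"
    using False unfolding structure_clique_width_def by (auto intro!: INF_lower)
  moreover have "width e' = card (unary_labels e) + 2 * card (binary_labels e)"
    using inj by (simp add: width_def e'_def cw_expr.set_map card_image)
  moreover have "\<dots> \<le> card U + 2 * card B"
    using assms(2,3) e by (intro add_mono mult_le_mono2 card_mono) auto
  ultimately show ?thesis by (metis enat_ord_simps(1) order_trans)
qed (simp add: structure_clique_width_def)

section \<open>Adding triples by their unary labels, with two binary labels\<close>

definition label_triples :: "('p \<Rightarrow> 'u) \<Rightarrow> 'p set \<Rightarrow> 'u \<times> 'u \<times> 'u \<Rightarrow> ('p \<times> 'p \<times> 'p) set" where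
  "label_triples lab A = (\<lambda>(i, j, k). \<Union>{cyclic_closure (a, b, c) | a b c. distinct [a, b, c] \<and>
     a \<in> A \<and> b \<in> A \<and> c \<in> A \<and> lab a = i \<and> lab b = j \<and> lab c = k})"

text \<open>The binary label \<^term>\<open>True\<close> is only a bin for pairs that are not needed any more.\<close>

definition realizes_with_bin ::
  "'u set \<Rightarrow> 'p set \<Rightarrow> ('p \<Rightarrow> 'u) \<Rightarrow> ('p \<times> 'p \<times> 'p) set \<Rightarrow> bool" where
  "realizes_with_bin U A lab R \<longleftrightarrow> (\<exists>M. snd ` M \<subseteq> {True} \<and> realizes U (UNIV :: bool set) A lab M R)"

text \<open>The pairs labelled \<open>(i, j)\<close> receive the binary label \<open>False\<close>,
  which no other pair carries at that moment. They are used once with third label \<open>k\<close>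
  and then moved to the bin, so that \<open>False\<close> is free again.\<close>

lemma realizes_with_bin_label_triples:
  assumes "realizes_with_bin U A lab R" "i \<in> U" "j \<in> U" "k \<in> U" "i \<noteq> j"
  shows "realizes_with_bin U A lab (R \<union> label_triples lab A (i, j, k))"
proof -
  obtain M where M: "snd ` M \<subseteq> {True}" "realizes U (UNIV :: bool set) A lab M R"
    using assms(1) by (auto simp: realizes_with_bin_def)
  let ?N = "{((a, b), False) | a b. a \<in> A \<and> b \<in> A \<and> lab a = i \<and> lab b = j}"
  have F: "((a, b), False) \<in> M \<union> ?N \<longleftrightarrow> a \<in> A \<and> b \<in> A \<and> lab a = i \<and> lab b = j" for a b
    using M(1) by force
  have "realizes U UNIV A lab (M \<union> ?N) R"
    by (rule realizes_label_pairs) (use assms M in auto)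
  then have "realizes U UNIV A lab (M \<union> ?N) (R \<union> \<Union>{cyclic_closure (a, b, c) | a b c.
      distinct [a, b, c] \<and> c \<in> A \<and> lab c = k \<and> ((a, b), False) \<in> M \<union> ?N})"
    by (rule realizes_add_triples) (use assms in auto)
  also have "\<Union>{cyclic_closure (a, b, c) | a b c.
      distinct [a, b, c] \<and> c \<in> A \<and> lab c = k \<and> ((a, b), False) \<in> M \<union> ?N} = label_triples lab A (i, j, k)"
    unfolding F label_triples_def by (simp add: conj_ac)
  finally have "realizes U UNIV A lab (M \<union> ?N) (R \<union> label_triples lab A (i, j, k))" .
  from realizes_relabel_binary[OF this, of False True]
  have "realizes U UNIV A lab {(q, if l = False then True else l) | q l. (q, l) \<in> M \<union> ?N}
    (R \<union> label_triples lab A (i, j, k))" by simp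
  moreover have "snd ` {(q, if l = False then True else l) | q l. (q, l) \<in> M \<union> ?N} \<subseteq> {True}"
    by auto
  ultimately show ?thesis unfolding realizes_with_bin_def by blast
qed

lemma realizes_with_bin_UN_label_triples:
  assumes "finite S" "realizes_with_bin U A lab R" "\<And>i j k. (i, j, k) \<in> S \<Longrightarrow> i \<in> U \<and> j \<in> U \<and> k \<in> U \<and> i \<noteq> j"
  shows "realizes_with_bin U A lab (R \<union> (\<Union>s\<in>S. label_triples lab A s))"
  using assms(1,3)
proof (induction S)
  case (insert s S)
  obtain i j k where s: "s = (i, j, k)" by (cases s)
  have "realizes_with_bin U A lab ((R \<union> (\<Union>s\<in>S. label_triples lab A s)) \<union> label_triples lab A (i, j, k))"
    by (rule realizes_with_bin_label_triples[OF insert.IH]) (use insert.prems s in blast)+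
  then show ?case by (simp add: s Un_ac)
qed (use assms(2) in simp)

lemma realizes_with_bin_insert:
  assumes "realizes_with_bin U A lab R" "p \<notin> A" "u \<in> U"
  shows "realizes_with_bin U (insert p A) (lab(p := u)) R"
  using realizes_insert[OF _ assms(2,3)] assms(1) unfolding realizes_with_bin_def by blast

lemma realizes_with_bin_relabel:
  assumes "realizes_with_bin U A lab R" "i \<in> U" "j \<in> U"
  shows "realizes_with_bin U A (\<lambda>p. if lab p = i then j else lab p) R"
  using realizes_relabel_unary[OF _ assms(2,3)] assms(1) unfolding realizes_with_bin_def by blast

lemma realizes_with_bin_cong:
  assumes "realizes_with_bin U A lab R" "\<And>p. p \<in> A \<Longrightarrow> lab p = lab' p" "R = R'"
  shows "realizes_with_bin U A lab' R'"
proof -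
  obtain M where M: "snd ` M \<subseteq> {True}" "realizes U (UNIV :: bool set) A lab M R"
    using assms(1) by (auto simp: realizes_with_bin_def)
  have "realizes U (UNIV :: bool set) A lab' M R'"
    by (rule realizes_cong[OF M(2)]) (use assms in simp_all)
  then show ?thesis using M(1) unfolding realizes_with_bin_def by (intro exI conjI)
qed

section \<open>Collinear points\<close>

lemma cyclic_closure_rotate:
  "cyclic_closure (b, c, a) = cyclic_closure (a, b, c)"
  by (auto simp: cyclic_closure_def)

lemma label_triples_subset_iff:
  "label_triples lab A (i, j, k) \<subseteq> R \<longleftrightarrow> (\<forall>a b c. distinct [a, b, c] \<longrightarrow> a \<in> A \<longrightarrow> b \<in> A \<longrightarrow> c \<in> A \<longrightarrow>
    lab a = i \<longrightarrow> lab b = j \<longrightarrow> lab c = k \<longrightarrow> cyclic_closure (a, b, c) \<subseteq> R)"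
  unfolding label_triples_def by auto blast

lemma cyclic_closure_subset_label_triples:
  assumes "distinct [a, b, c]" "a \<in> A" "b \<in> A" "c \<in> A"
  shows "cyclic_closure (a, b, c) \<subseteq> label_triples lab A (lab a, lab b, lab c)"
  unfolding label_triples_def using assms by auto

lemma realizes_distinct_labels:
  assumes "finite A" "lab ` A \<subseteq> U"
  shows "realizes U B A lab {} {}"
  using assms
proof (induction A)
  case (insert p A)
  then have "realizes U B (insert p A) (lab(p := lab p)) {} {}"
    by (intro realizes_insert) auto
  then show ?case by simp
qed (rule realizes_empty)

text \<open>The points of \<open>V\<close> are inserted from left to right. Seen from a point of
  \<open>D\<close>, all earlier points of \<open>V\<close> have the same orientation with respect to
  the new one, so they may share the label \<open>Inr False\<close>; only the new point needs
  \<open>Inr True\<close>, and it joins the others afterwards. In the application \<open>P\<close>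
  and \<open>Q\<close> are the two open sides of the line; both fail for a point of \<open>D\<close>
  on the line itself.\<close>

lemma realizes_line_and_points:
  fixes T :: "'p \<Rightarrow> 'p \<Rightarrow> 'p \<Rightarrow> bool" and pos :: "'p \<Rightarrow> real"
  assumes "finite V" "finite D" "V \<inter> D = {}" "inj_on pos V"
    and cyc: "\<And>a b c. T a b c \<longleftrightarrow> T b c a"
    and line: "\<And>a b c. a \<in> V \<Longrightarrow> b \<in> V \<Longrightarrow> c \<in> V \<Longrightarrow> \<not> T a b c"
    and side1: "\<And>a b x. a \<in> V \<Longrightarrow> b \<in> V \<Longrightarrow> pos a < pos b \<Longrightarrow> x \<in> D \<Longrightarrow> T a b x \<longleftrightarrow> P x"
    and side2: "\<And>a b x. a \<in> V \<Longrightarrow> b \<in> V \<Longrightarrow> pos a < pos b \<Longrightarrow> x \<in> D \<Longrightarrow> T b a x \<longleftrightarrow> Q x"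
  shows "realizes_with_bin (Inl ` D \<union> range Inr) (V \<union> D) (\<lambda>p. if p \<in> D then Inl p else Inr False)
    (triples_of T (V \<union> D))"
proof -
  have "S \<subseteq> V \<Longrightarrow> realizes_with_bin (Inl ` D \<union> range Inr) (S \<union> D)
      (\<lambda>p. if p \<in> D then Inl p else Inr False) (triples_of T (S \<union> D))" if "finite S" for S
    using that
  proof (induction S rule: finite_ranking_induct[where f = pos, consumes 1])
    show "realizes_with_bin (Inl ` D \<union> range Inr) ({} \<union> D) (\<lambda>p. if p \<in> D then Inl p else Inr False)
      (triples_of T ({} \<union> D))"
    proof -
      let ?lab = "\<lambda>p. if p \<in> D then Inl p else Inr False :: 'p + bool"
      \<comment> \<open>Each point of \<open>D\<close> has its own label, so a label triple singles
        out one triple of points.\<close>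
      let ?S = "{(Inl x, Inl y, Inl z) | x y z. x \<in> D \<and> y \<in> D \<and> z \<in> D \<and> distinct [x, y, z] \<and> T x y z}"
      have "realizes (Inl ` D \<union> range Inr) UNIV D ?lab {} {}"
        by (rule realizes_distinct_labels) (use assms(2) in auto)
      then have "realizes_with_bin (Inl ` D \<union> range Inr) D ?lab {}"
        unfolding realizes_with_bin_def by (intro exI[of _ "{}"]) simp
      moreover have "?S \<subseteq> Inl ` D \<times> Inl ` D \<times> Inl ` D" by auto
      then have "finite ?S" by (rule finite_subset) (use assms(2) in simp)
      ultimately have "realizes_with_bin (Inl ` D \<union> range Inr) D ?lab ({} \<union> (\<Union>s\<in>?S. label_triples ?lab D s))"
        by (intro realizes_with_bin_UN_label_triples) auto
      moreover have "(\<Union>s\<in>?S. label_triples ?lab D s) = triples_of T D"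
      proof
        have "\<And>a b c. T a b c \<Longrightarrow> T b c a" using cyc by blast
        then show "(\<Union>s\<in>?S. label_triples ?lab D s) \<subseteq> triples_of T D"
          by (fastforce simp: label_triples_def triples_of_def cyclic_closure_def)
        show "triples_of T D \<subseteq> (\<Union>s\<in>?S. label_triples ?lab D s)"
        proof
          fix t assume "t \<in> triples_of T D"
          then obtain a b c where t: "t = (a, b, c)" "a \<in> D" "b \<in> D" "c \<in> D" "distinct [a, b, c]" "T a b c"
            by (auto simp: triples_of_def)
          then have "t \<in> label_triples ?lab D (?lab a, ?lab b, ?lab c)"
            using cyclic_closure_subset_label_triples[of a b c D ?lab] by (auto simp: cyclic_closure_def)
          moreover have "(?lab a, ?lab b, ?lab c) \<in> ?S" using t by auto
          ultimately show "t \<in> (\<Union>s\<in>?S. label_triples ?lab D s)" by blast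
        qed
      qed
      ultimately show ?thesis by simp
    qed
  next
    fix v S
    assume fin: "finite S" and max: "\<And>y. y \<in> S \<Longrightarrow> pos y \<le> pos v"
      and IH: "S \<subseteq> V \<Longrightarrow> realizes_with_bin (Inl ` D \<union> range Inr) (S \<union> D)
          (\<lambda>p. if p \<in> D then Inl p else Inr False) (triples_of T (S \<union> D))"
      and sub: "insert v S \<subseteq> V"
    let ?U = "Inl ` D \<union> range Inr :: ('p + bool) set"
    let ?lab = "\<lambda>p. if p \<in> D then Inl p else Inr False :: 'p + bool"
    show "realizes_with_bin ?U (insert v S \<union> D) ?lab (triples_of T (insert v S \<union> D))"
    proof (cases "v \<in> S")
      case True
      then show ?thesis using IH sub by (simp add: insert_absorb)
    next
      case False
      have vD: "v \<notin> D" and SD: "\<And>a. a \<in> S \<Longrightarrow> a \<notin> D" using sub assms(3) by auto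
      have less: "pos a < pos v" if "a \<in> S" for a
        using max[OF that] inj_onD[OF assms(4), of a v] that sub False by fastforce
      let ?A = "insert v (S \<union> D)"
      let ?l = "?lab(v := Inr True)"
      \<comment> \<open>The new triples through \<open>v\<close>: two points of \<open>D\<close>, or
        one earlier point of the line and one point of \<open>D\<close>, in either orientation. Two
        earlier points of the line give none.\<close>
      define X where "X = {(Inl x, Inl y, Inr True) | x y. x \<in> D \<and> y \<in> D \<and> x \<noteq> y \<and> T x y v} \<union>
        {(Inr False, Inr True, Inl x) | x. x \<in> D \<and> P x} \<union> {(Inr True, Inr False, Inl x) | x. x \<in> D \<and> Q x}"
      have "X \<subseteq> ?U \<times> ?U \<times> ?U" by (auto simp: X_def)
      then have finX: "finite X" by (rule finite_subset) (use assms(2) in simp)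
      have X: "(\<Union>s\<in>X. label_triples ?l ?A s) =
          \<Union>{cyclic_closure (a, b, v) | a b. a \<in> S \<union> D \<and> b \<in> S \<union> D \<and> a \<noteq> b \<and> T a b v}" (is "_ = ?R")
      proof
        have "label_triples ?l ?A s \<subseteq> ?R" if "s \<in> X" for s
        proof -
          consider x y where "s = (Inl x, Inl y, Inr True)" "x \<in> D" "y \<in> D" "x \<noteq> y" "T x y v"
            | x where "s = (Inr False, Inr True, Inl x)" "x \<in> D" "P x"
            | x where "s = (Inr True, Inr False, Inl x)" "x \<in> D" "Q x"
            using \<open>s \<in> X\<close> unfolding X_def by blast
          then show ?thesis
          proof cases
            case 1
            then show ?thesis
              unfolding \<open>s = _\<close> label_triples_subset_iff by (auto split: if_splits)
          next
            case 2
            show ?thesis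
              unfolding \<open>s = _\<close> label_triples_subset_iff
            proof (intro allI impI)
              fix a b c assume h: "distinct [a, b, c]" "a \<in> ?A" "b \<in> ?A" "c \<in> ?A" "?l a = Inr False"
                "?l b = Inr True" "?l c = Inl x"
              then have "b = v" "c = x" "a \<in> S" using 2 by (auto split: if_splits)
              then have "T x a v" using side1[of a v x] sub less 2 cyc by blast
              moreover have "cyclic_closure (a, b, c) = cyclic_closure (x, a, v)"
                using \<open>b = v\<close> \<open>c = x\<close> by (simp add: cyclic_closure_rotate)
              ultimately show "cyclic_closure (a, b, c) \<subseteq> ?R" using \<open>a \<in> S\<close> 2 SD by blast
            qed
          next
            case 3
            show ?thesis
              unfolding \<open>s = _\<close> label_triples_subset_iff
            proof (intro allI impI)
              fix a b c assume h: "distinct [a, b, c]" "a \<in> ?A" "b \<in> ?A" "c \<in> ?A" "?l a = Inr True"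
                "?l b = Inr False" "?l c = Inl x"
              then have "a = v" "c = x" "b \<in> S" using 3 by (auto split: if_splits)
              then have "T b x v" using side2[of b v x] sub less 3 cyc by blast
              moreover have "cyclic_closure (a, b, c) = cyclic_closure (b, x, v)"
                using \<open>a = v\<close> \<open>c = x\<close> cyclic_closure_rotate by metis
              ultimately show "cyclic_closure (a, b, c) \<subseteq> ?R" using \<open>b \<in> S\<close> 3 SD by blast
            qed
          qed
        qed
        then show "(\<Union>s\<in>X. label_triples ?l ?A s) \<subseteq> ?R" by blast
      next
        have "cyclic_closure (a, b, v) \<subseteq> (\<Union>s\<in>X. label_triples ?l ?A s)"
          if h: "a \<in> S \<union> D" "b \<in> S \<union> D" "a \<noteq> b" "T a b v" for a b
        proof -
          have ne: "a \<noteq> v" "b \<noteq> v" using h(1,2) False vD by auto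
          consider "a \<in> D" "b \<in> D" | "a \<in> D" "b \<in> S" | "a \<in> S" "b \<in> D" | "a \<in> S" "b \<in> S"
            using h by blast
          then show ?thesis
          proof cases
            case 1
            then have "(?l a, ?l b, ?l v) \<in> X" using ne h by (auto simp: X_def)
            then show ?thesis
              using cyclic_closure_subset_label_triples[of a b v ?A ?l] h ne by fastforce
          next
            case 2
            have "P a" using side1[of b v a] sub less 2 cyc h(4) by blast
            then have "(?l b, ?l v, ?l a) \<in> X" using ne 2 SD by (auto simp: X_def)
            then show ?thesis
              using cyclic_closure_subset_label_triples[of b v a ?A ?l] h ne 
              by (fastforce simp: cyclic_closure_rotate)
          next
            case 3
            have "Q b" using side2[of a v b] sub less 3 cyc h(4) by blast
            then have "(?l v, ?l a, ?l b) \<in> X" using ne 3 SD by (auto simp: X_def)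
            then show ?thesis
              using cyclic_closure_subset_label_triples[of v a b ?A ?l] h ne 
              by (fastforce simp: cyclic_closure_rotate)
          next
            case 4
            then show ?thesis using line[of a b v] sub h(4) by blast
          qed
        qed
        then show "?R \<subseteq> (\<Union>s\<in>X. label_triples ?l ?A s)" by blast
      qed
      have "realizes_with_bin ?U ?A ?l (triples_of T (S \<union> D))"
        by (rule realizes_with_bin_insert) (use IH sub False vD in auto)
      then have "realizes_with_bin ?U ?A ?l (triples_of T (S \<union> D) \<union> (\<Union>s\<in>X. label_triples ?l ?A s))"
        by (rule realizes_with_bin_UN_label_triples[OF finX]) (auto simp: X_def)
      also have "triples_of T (S \<union> D) \<union> (\<Union>s\<in>X. label_triples ?l ?A s) = triples_of T ?A"
        unfolding X using triples_of_insert[of T v "S \<union> D"] cyc False vD by auto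
      finally have "realizes_with_bin ?U ?A ?l (triples_of T ?A)" .
      then have "realizes_with_bin ?U ?A (\<lambda>p. if ?l p = Inr True then Inr False else ?l p) (triples_of T ?A)"
        by (rule realizes_with_bin_relabel) auto
      then show ?thesis
        unfolding Un_insert_left by (rule realizes_with_bin_cong) (use vD in auto)
    qed
  qed
  then show ?thesis using assms(1) by simp
qed

lemma ccw_triangle_iff:
  "ccw_triangle a b c \<longleftrightarrow> (b$1 - a$1) * (c$2 - a$2) - (b$2 - a$2) * (c$1 - a$1) > 0"
  by (simp add: ccw_triangle_def det_2)

lemma ccw_triangle_rotate: "ccw_triangle a b c \<longleftrightarrow> ccw_triangle b c a"
  by (simp add: ccw_triangle_iff algebra_simps)

lemma order_type_eq: "order_type P = triples_of ccw_triangle P"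
  by (simp add: order_type_def triples_of_def)

lemma clique_width_collinear:
  assumes "finite P" "P0 \<subseteq> P" "collinear P0"
  shows "clique_width P \<le> enat (6 * (card (P - P0) + 1))"
proof -
  define D where "D = P - P0"
  have fin: "finite P0" "finite D" and P: "P = P0 \<union> D" and disj: "P0 \<inter> D = {}"
    using assms by (auto simp: D_def finite_subset)
  obtain u :: "real ^ 2" where u: "\<And>x y. x \<in> P0 \<Longrightarrow> y \<in> P0 \<Longrightarrow> \<exists>c. x - y = c *\<^sub>R u"
    using assms(3) unfolding collinear_def by blast
  obtain w where w: "P0 \<noteq> {} \<Longrightarrow> w \<in> P0" by blast
  have "\<forall>p\<in>P0. \<exists>c. p - w = c *\<^sub>R u" using u w by blast
  then obtain pos where pos': "\<forall>p\<in>P0. p - w = pos p *\<^sub>R u" using bchoice by meson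
  have pos: "p = w + pos p *\<^sub>R u" if "p \<in> P0" for p
    using bspec[OF pos' that] by (simp add: algebra_simps)
  have inj: "inj_on pos P0"
    by (rule inj_onI, subst pos, assumption, subst (3) pos, assumption) simp
  have coord: "p $ 1 = w $ 1 + pos p * u $ 1" "p $ 2 = w $ 2 + pos p * u $ 2" if "p \<in> P0" for p
    using arg_cong[OF pos[OF that], of "\<lambda>v. v $ 1"] arg_cong[OF pos[OF that], of "\<lambda>v. v $ 2"]
    by auto
  \<comment> \<open>The cross product of the direction \<open>u\<close> with \<open>x - w\<close>;
    its sign tells the side of the line on which \<open>x\<close> lies.\<close>
  define s where "s x = u $ 1 * (x $ 2 - w $ 2) - u $ 2 * (x $ 1 - w $ 1)" for x :: "real ^ 2"
  have ccw: "ccw_triangle a b x \<longleftrightarrow> (pos b - pos a) * s x > 0" if "a \<in> P0" "b \<in> P0" for a b x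
    unfolding ccw_triangle_iff s_def coord[OF that(1)] coord[OF that(2)]
    by (simp add: algebra_simps)
  have "realizes_with_bin (Inl ` D \<union> range Inr) (P0 \<union> D) (\<lambda>p. if p \<in> D then Inl p else Inr False)
      (triples_of ccw_triangle (P0 \<union> D))"
  proof (rule realizes_line_and_points[OF fin disj inj ccw_triangle_rotate,
        where P = "\<lambda>x. s x > 0" and Q = "\<lambda>x. s x < 0"])
    show "\<not> ccw_triangle a b c" if "a \<in> P0" "b \<in> P0" "c \<in> P0" for a b c
      unfolding ccw[OF that(1,2)] s_def coord[OF that(3)] by simp
  qed (simp_all add: ccw zero_less_mult_iff)
  then obtain M where "realizes (Inl ` D \<union> range Inr) (UNIV :: bool set) P
      (\<lambda>p. if p \<in> D then Inl p else Inr False) M (order_type P)"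
    unfolding realizes_with_bin_def P order_type_eq by blast
  then have "clique_width P \<le> enat (card (Inl ` D \<union> range Inr :: (real ^ 2 + bool) set) + 2 * card (UNIV :: bool set))"
    unfolding clique_width_def by (rule structure_clique_width_le) (use fin in auto)
  \<comment> \<open>One label for each point of \<open>D\<close> and two for the line, plus two
    binary labels counted twice, make at most \<open>card D + 6\<close>.\<close>
  also have "card (Inl ` D \<union> range Inr :: (real ^ 2 + bool) set) \<le> card D + 2"
    using card_Un_le[of "Inl ` D" "range Inr :: (real ^ 2 + bool) set"]
    by (simp add: card_image)
  then have "enat (card (Inl ` D \<union> range Inr :: (real ^ 2 + bool) set) + 2 * card (UNIV :: bool set))
      \<le> enat (6 * (card D + 1))"
    by simp
  finally show ?thesis by (simp add: D_def)
qed

section \<open>Convex position and one more point\<close>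

lemma realizes_UN_label_pairs:
  assumes "finite S" "realizes U B A lab M R" "S \<subseteq> U \<times> U \<times> B" "\<And>i j k. (i, j, k) \<in> S \<Longrightarrow> i \<noteq> j"
  shows "realizes U B A lab (M \<union> {((a, b), k) | a b k. a \<in> A \<and> b \<in> A \<and> (lab a, lab b, k) \<in> S}) R"
  using assms(1,3,4)
proof (induction S)
  case empty
  then show ?case using assms(2) by simp
next
  case (insert s S)
  obtain i j k where s: "s = (i, j, k)" by (cases s)
  have mem: "i \<in> U" "j \<in> U" "k \<in> B" "i \<noteq> j" using insert.prems s by auto
  have "realizes U B A lab (M \<union> {((a, b), k) | a b k. a \<in> A \<and> b \<in> A \<and> (lab a, lab b, k) \<in> S}) R"
    by (rule insert.IH) (use insert.prems in auto)
  from realizes_label_pairs[OF this mem(1,2,4,3)] show ?case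
    by (rule realizes_cong) (auto simp: s)
qed

lemma realizes_UN_add_triples:
  assumes "finite S" "realizes U B A lab M R" "S \<subseteq> U \<times> B"
  shows "realizes U B A lab M (R \<union> \<Union>{cyclic_closure (a, b, c) | a b c. distinct [a, b, c] \<and>
    c \<in> A \<and> (\<exists>k. (lab c, k) \<in> S \<and> ((a, b), k) \<in> M)})"
  using assms(1,3)
proof (induction S)
  case empty
  then show ?case using assms(2) by simp
next
  case (insert s S)
  obtain i k where s: "s = (i, k)" by (cases s)
  have mem: "i \<in> U" "k \<in> B" using insert.prems s by auto
  have "realizes U B A lab M (R \<union> \<Union>{cyclic_closure (a, b, c) | a b c. distinct [a, b, c] \<and>
    c \<in> A \<and> (\<exists>k. (lab c, k) \<in> S \<and> ((a, b), k) \<in> M)})"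
    by (rule insert.IH) (use insert.prems in auto)
  from realizes_add_triples[OF this mem] show ?case
    by (rule realizes_cong) (simp, simp, unfold s, blast)
qed

lemma realizes_UN_add_reversed_triples:
  assumes "finite S" "realizes U B A lab M R" "S \<subseteq> U \<times> B"
  shows "realizes U B A lab M (R \<union> \<Union>{cyclic_closure (b, a, c) | a b c. distinct [a, b, c] \<and>
    c \<in> A \<and> (\<exists>k. (lab c, k) \<in> S \<and> ((a, b), k) \<in> M)})"
  using assms(1,3)
proof (induction S)
  case empty
  then show ?case using assms(2) by simp
next
  case (insert s S)
  obtain i k where s: "s = (i, k)" by (cases s)
  have mem: "i \<in> U" "k \<in> B" using insert.prems s by auto
  have "realizes U B A lab M (R \<union> \<Union>{cyclic_closure (b, a, c) | a b c. distinct [a, b, c] \<and>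
    c \<in> A \<and> (\<exists>k. (lab c, k) \<in> S \<and> ((a, b), k) \<in> M)})"
    by (rule insert.IH) (use insert.prems in auto)
  from realizes_add_reversed_triples[OF this mem] show ?case
    by (rule realizes_cong) (simp, simp, unfold s, blast)
qed

text \<open>The second component of a unary label is \<^term>\<open>None\<close> for the point being inserted,
  \<^term>\<open>Some True\<close> for the point inserted before it and \<^term>\<open>Some False\<close> for all others.\<close>

lemma realizes_ordered:
  fixes T :: "'p \<Rightarrow> 'p \<Rightarrow> 'p \<Rightarrow> bool" and pos :: "'p \<Rightarrow> nat" and ty :: "'p \<Rightarrow> 't :: finite"
  assumes "finite V" "inj_on pos V"
    and cyc: "\<And>a b c. T a b c \<longleftrightarrow> T b c a"
    and asym: "\<And>a b c. a \<in> V \<Longrightarrow> b \<in> V \<Longrightarrow> c \<in> V \<Longrightarrow> distinct [a, b, c] \<Longrightarrow> T b a c \<longleftrightarrow> \<not> T a b c"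
    and F: "\<And>a b c. a \<in> V \<Longrightarrow> b \<in> V \<Longrightarrow> c \<in> V \<Longrightarrow> pos a < pos b \<Longrightarrow> pos b < pos c \<Longrightarrow>
      T a b c \<longleftrightarrow> F (ty a) (ty b) (ty c)"
    and tie: "\<And>a b c. a \<in> V \<Longrightarrow> b \<in> V \<Longrightarrow> c \<in> V \<Longrightarrow> pos a < pos b \<Longrightarrow> pos b < pos c \<Longrightarrow> \<not> tie a c"
  shows "\<exists>u. realizes UNIV UNIV V (\<lambda>p. Some (ty p, Some (p = u)))
    {((a, b), (ty a, ty b, tie a b)) | a b. a \<in> V \<and> b \<in> V \<and> pos a < pos b} (triples_of T V)"
proof -
  define M where "M S = {((a, b), (ty a, ty b, tie a b)) | a b. a \<in> S \<and> b \<in> S \<and> pos a < pos b}" for S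
  \<comment> \<open>Points are inserted by increasing \<open>pos\<close>. The point \<open>u\<close>
    inserted last has to be remembered, as it is the only one that can be tied with the next
    point.\<close>
  have "S \<subseteq> V \<Longrightarrow> \<exists>u. (S \<noteq> {} \<longrightarrow> u \<in> S) \<and> (\<forall>q\<in>S. pos q \<le> pos u) \<and>
    realizes UNIV UNIV S (\<lambda>p. Some (ty p, Some (p = u))) (M S) (triples_of T S)" if "finite S" for S
    using that
  proof (induction S rule: finite_ranking_induct[where f = pos, consumes 1])
    case empty
    then show ?case by (simp add: M_def realizes_empty)
  next
    case (insert v S)
    show ?case
    proof (cases "v \<in> S")
      case True
      then show ?thesis using insert by (simp add: insert_absorb)
    next
      case False
      have sub: "S \<subseteq> V" "v \<in> V" using insert.prems by auto
      have less: "pos a < pos v" if "a \<in> S" for a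
        using insert.hyps(2)[OF that] inj_onD[OF assms(2), of a v] that sub False by fastforce
      obtain u where u: "S \<noteq> {} \<Longrightarrow> u \<in> S" "\<And>q. q \<in> S \<Longrightarrow> pos q \<le> pos u"
        and r: "realizes UNIV UNIV S (\<lambda>p. Some (ty p, Some (p = u))) (M S) (triples_of T S)"
        using insert.IH sub by blast
      let ?A = "insert v S"
      let ?new = "Some (ty v, None) :: ('t \<times> bool option) option"
      define l where "l = (\<lambda>p. Some (ty p, Some (p = u)))(v := ?new)"
      have lnew: "l c = ?new \<longleftrightarrow> c = v" for c by (simp add: l_def)
      have r1: "realizes UNIV UNIV ?A l (M S) (triples_of T S)"
        unfolding l_def by (rule realizes_insert) (use r False in auto)
      \<comment> \<open>The label of an earlier pair shows its order and both types. With the type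
        of \<open>v\<close> this fixes the value of \<open>F\<close>, which decides between the
        triple and its reversal.\<close>
      define X where "X b = {(?new, (t1, t2, d)) | t1 t2 (d :: bool). F t1 t2 (ty v) = b}" for b
      note r2 = realizes_UN_add_reversed_triples[OF _ realizes_UN_add_triples[OF _ r1, of "X True"], of "X False"]
      have Mk: "(\<exists>k. (l c, k) \<in> X f \<and> ((a, b), k) \<in> M S) \<longleftrightarrow>
          c = v \<and> a \<in> S \<and> b \<in> S \<and> pos a < pos b \<and> F (ty a) (ty b) (ty v) = f" for a b c f
        unfolding X_def M_def using lnew by auto
      have T_iff: "T a b v \<longleftrightarrow> F (ty a) (ty b) (ty v)" "T b a v \<longleftrightarrow> \<not> F (ty a) (ty b) (ty v)"
        if "a \<in> S" "b \<in> S" "pos a < pos b" for a b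
      proof -
        have "distinct [a, b, v]" using that False by auto
        then show "T a b v \<longleftrightarrow> F (ty a) (ty b) (ty v)" "T b a v \<longleftrightarrow> \<not> F (ty a) (ty b) (ty v)"
          using F[of a b v] asym[of a b v] that sub less by auto
      qed
      have "realizes UNIV UNIV ?A l (M S) (triples_of T ?A)"
      proof (rule realizes_cong[OF r2 refl refl])
        show "triples_of T S \<union>
          \<Union>{cyclic_closure (a, b, c) | a b c. distinct [a, b, c] \<and> c \<in> ?A \<and>
              (\<exists>k. (l c, k) \<in> X True \<and> ((a, b), k) \<in> M S)} \<union>
          \<Union>{cyclic_closure (b, a, c) | a b c. distinct [a, b, c] \<and> c \<in> ?A \<and>
              (\<exists>k. (l c, k) \<in> X False \<and> ((a, b), k) \<in> M S)} = triples_of T ?A" (is "_ \<union> ?L1 \<union> ?L2 = _")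
        proof -
          have "?L1 \<union> ?L2 = \<Union>{cyclic_closure (a, b, v) | a b. a \<in> S \<and> b \<in> S \<and> a \<noteq> b \<and> T a b v}"
            (is "_ = ?R")
          proof
            have "?L1 \<subseteq> ?R" unfolding Mk
            proof (rule Union_least, elim CollectE exE conjE)
              fix x a b c assume "x = cyclic_closure (a, b, c)" "c = v" "distinct [a, b, c]"
                "a \<in> S" "b \<in> S" "pos a < pos b" "F (ty a) (ty b) (ty v) = True"
              then show "x \<subseteq> ?R" using T_iff(1)[of a b] by fastforce
            qed
            moreover have "?L2 \<subseteq> ?R" unfolding Mk
            proof (rule Union_least, elim CollectE exE conjE)
              fix x a b c assume "x = cyclic_closure (b, a, c)" "c = v" "distinct [a, b, c]"
                "a \<in> S" "b \<in> S" "pos a < pos b" "F (ty a) (ty b) (ty v) = False"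
              then show "x \<subseteq> ?R" using T_iff(2)[of a b] by fastforce
            qed
            ultimately show "?L1 \<union> ?L2 \<subseteq> ?R" by (rule Un_least)
            have "cyclic_closure (a, b, v) \<subseteq> ?L1 \<union> ?L2" if ab: "a \<in> S" "b \<in> S" "a \<noteq> b" "T a b v" for a b
            proof -
              have d: "distinct [a, b, v]" "distinct [b, a, v]" using ab False by auto
              have "pos a \<noteq> pos b" using ab sub inj_onD[OF assms(2), of a b] by blast
              then consider "pos a < pos b" | "pos b < pos a" by linarith
              then show ?thesis
              proof cases
                case 1
                then have "cyclic_closure (a, b, v) \<subseteq> ?L1"
                  unfolding Mk using T_iff(1)[of a b] ab d(1) by blast
                then show ?thesis by (rule le_supI1)
              next
                case 2
                then have "cyclic_closure (a, b, v) \<subseteq> ?L2"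
                  unfolding Mk using T_iff(2)[of b a] ab d(2) by blast
                then show ?thesis by (rule le_supI2)
              qed
            qed
            then show "?R \<subseteq> ?L1 \<union> ?L2"
              by (intro Union_least) (elim CollectE exE conjE, simp only:)
          qed
          then show ?thesis
            using triples_of_insert[of T v S, OF cyc False] by (simp only: Un_assoc)
        qed
      qed simp_all
      \<comment> \<open>The pairs ending in the new point. A tie with any earlier point except
        \<open>u\<close> would have \<open>u\<close> strictly in between, which the hypothesis on
        \<open>tie\<close> excludes; hence the bit \<open>False\<close> for these.\<close>
      define Y where "Y = {(Some (t, Some False), ?new, (t, ty v, False)) | t. True} \<union>
        {(Some (ty u, Some True), ?new, (ty u, ty v, tie u v))}"
      have "realizes UNIV UNIV ?A l (M S \<union> {((a, b), k) | a b k. a \<in> ?A \<and> b \<in> ?A \<and> (l a, l b, k) \<in> Y})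
          (triples_of T ?A)"
        by (rule realizes_UN_label_pairs) (use \<open>realizes UNIV UNIV ?A l (M S) (triples_of T ?A)\<close> in \<open>auto simp: Y_def\<close>)
      moreover have "M S \<union> {((a, b), k) | a b k. a \<in> ?A \<and> b \<in> ?A \<and> (l a, l b, k) \<in> Y} = M ?A"
      proof -
        have notie: "tie a v \<longleftrightarrow> a = u \<and> tie u v" if "a \<in> S" for a
        proof (cases "a = u")
          case False
          have "u \<in> S" using u that by auto
          then have "pos a < pos u"
            using u(2)[OF that] inj_onD[OF assms(2), of a u] that sub False by fastforce
          then show ?thesis using tie[of a u v] \<open>u \<in> S\<close> that sub less False by blast
        qed simp
        have Yk: "(l a, l b, k) \<in> Y \<longleftrightarrow> b = v \<and> k = (ty a, ty v, tie a v)" if "a \<in> S" for a b k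
          using that False notie[OF that] lnew by (auto simp: Y_def l_def)
        have Yv: "(l v, l b, k) \<notin> Y" for b k by (auto simp: Y_def l_def)
        have "M ?A = M S \<union> {((a, v), (ty a, ty v, tie a v)) | a. a \<in> S}"
          unfolding M_def using less by (auto dest: less_asym)
        also have "{((a, v), (ty a, ty v, tie a v)) | a. a \<in> S} =
          {((a, b), k) | a b k. a \<in> ?A \<and> b \<in> ?A \<and> (l a, l b, k) \<in> Y}"
          using Yk Yv by blast
        finally show ?thesis by simp
      qed
      ultimately have r3: "realizes UNIV UNIV ?A l (M ?A) (triples_of T ?A)" by simp
      \<comment> \<open>First \<open>u\<close> loses its mark as the last point, then
        \<open>v\<close> receives it.\<close>
      from realizes_relabel_unary[OF realizes_relabel_unary[OF this, of "Some (ty u, Some True)" "Some (ty u, Some False)"],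
          of ?new "Some (ty v, Some True)"]
      have "realizes UNIV UNIV ?A (\<lambda>p. Some (ty p, Some (p = v))) (M ?A) (triples_of T ?A)"
        by (rule realizes_cong) (use False in \<open>auto simp: l_def\<close>)
      then show ?thesis using less by (intro exI[of _ v]) (auto intro: less_imp_le)
    qed
  qed
  then show ?thesis using assms(1) unfolding M_def by blast
qed

section \<open>Twice the signed area of a triangle\<close>

definition area2 :: "real ^ 2 \<Rightarrow> real ^ 2 \<Rightarrow> real ^ 2 \<Rightarrow> real" where
  "area2 a b c = (b$1 - a$1) * (c$2 - a$2) - (b$2 - a$2) * (c$1 - a$1)"

lemma ccw_area2: "ccw_triangle a b c \<longleftrightarrow> area2 a b c > 0"
  by (simp add: ccw_triangle_iff area2_def)

lemma area2_rotate: "area2 b c a = area2 a b c"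
  by (simp add: area2_def algebra_simps)

lemma area2_swap: "area2 b a c = - area2 a b c"
  by (simp add: area2_def algebra_simps)

lemma area2_decompose: "area2 p q r = area2 x q r + area2 x r p + area2 x p q"
  by (simp add: area2_def algebra_simps)

text \<open>Up to the common factor \<open>area2 p q r\<close>, the coefficients are the barycentric
  coordinates of \<open>x\<close> in the triangle. The form without division also covers degenerate
  triangles.\<close>

lemma area2_barycentric:
  "area2 x q r *\<^sub>R (p - x) + area2 x r p *\<^sub>R (q - x) + area2 x p q *\<^sub>R (r - x) = 0"
  by (simp add: vec_eq_iff forall_2 area2_def algebra_simps)

lemma area2_eq_0_imp_collinear:
  assumes "area2 p q r = 0"
  shows "collinear {p, q, r}"
proof (cases "p = q")
  case False
  have "\<exists>c. r - p = c *\<^sub>R (q - p)"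
  proof (cases "q $ 1 = p $ 1")
    case True
    then have "q $ 2 \<noteq> p $ 2" using False by (auto simp: vec_eq_iff forall_2)
    moreover from this have "r $ 1 = p $ 1" using assms True by (simp add: area2_def)
    ultimately show ?thesis using True
      by (intro exI[of _ "(r $ 2 - p $ 2) / (q $ 2 - p $ 2)"]) (simp add: vec_eq_iff forall_2)
  next
    case False
    then have "r $ 2 - p $ 2 = (r $ 1 - p $ 1) / (q $ 1 - p $ 1) * (q $ 2 - p $ 2)"
      using assms by (simp add: area2_def nonzero_eq_divide_eq mult.commute)
    then show ?thesis using False
      by (intro exI[of _ "(r $ 1 - p $ 1) / (q $ 1 - p $ 1)"]) (simp add: vec_eq_iff forall_2)
  qed
  then obtain c where "r - p = c *\<^sub>R (q - p)" by blast
  then have "collinear {0, q - p, r - p}" unfolding collinear_lemma by blast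
  then have "collinear {q, p, r}" by (subst collinear_3) simp
  then show ?thesis by (simp add: insert_commute)
qed simp

text \<open>Of three collinear points one lies between the other two, and so it cannot be an extreme
  point.\<close>

lemma strictly_convex_area2:
  assumes "strictly_convex_position S" "p \<in> S" "q \<in> S" "r \<in> S" "distinct [p, q, r]"
  shows "area2 p q r \<noteq> 0"
proof
  have no: "c \<notin> closed_segment a b" if "a \<in> S" "b \<in> S" "c \<in> S" "c \<noteq> a" "c \<noteq> b" for a b c
  proof -
    have "c extreme_point_of convex hull S" using assms(1) that by (simp add: strictly_convex_position_def)
    then have "c \<notin> open_segment a b"
      using that hull_inc[of a S convex] hull_inc[of b S convex] by (simp add: extreme_point_of_def)
    then show ?thesis using that by (simp add: open_segment_def)
  qed
  assume "area2 p q r = 0"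
  then have "collinear {p, q, r}" by (rule area2_eq_0_imp_collinear)
  then show False
    using no[of p q r] no[of q r p] no[of r p q] assms(2-)
    by (auto simp: collinear_between_cases between_mem_segment)
qed

section \<open>Orientation of convex points as seen from another point\<close>

text \<open>Seen from \<^term>\<open>x\<close>, a vertex \<^term>\<open>p\<close> of the convex hull of \<^term>\<open>S\<close> is far
  if its ray leaves the hull in \<^term>\<open>p\<close>. Otherwise the ray enters the hull in \<^term>\<open>p\<close>.\<close>

definition far_from :: "real ^ 2 \<Rightarrow> (real ^ 2) set \<Rightarrow> real ^ 2 \<Rightarrow> bool" where
  "far_from x S p \<longleftrightarrow> (\<forall>t>1. x + t *\<^sub>R (p - x) \<notin> convex hull S)"

text \<open>Under the sign condition, the ray from \<^term>\<open>x\<close> through \<^term>\<open>r\<close> meets the segment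
  from \<^term>\<open>p\<close> to \<^term>\<open>q\<close>, and the orientation tells which of the two is met first.\<close>

lemma ccw_iff_far_from:
  assumes "strictly_convex_position S" "p \<in> S" "q \<in> S" "r \<in> S" "distinct [p, q, r]" "x \<notin> S"
    and signs: "area2 x q r \<ge> 0" "area2 x r p \<ge> 0" "area2 x p q \<le> 0"
  shows "ccw_triangle p q r \<longleftrightarrow> far_from x S r"
proof -
  have nz: "area2 p q r \<noteq> 0" by (rule strictly_convex_area2) (use assms in auto)
  have rx: "r - x \<noteq> 0" using assms by auto
  define s where "s = area2 x q r + area2 x r p"
  \<comment> \<open>If both summands vanish, the barycentric identity forces the third area to
    vanish as well, and then \<open>p\<close>, \<open>q\<close>, \<open>r\<close> would be
    collinear.\<close>
  have "s \<noteq> 0"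
  proof
    assume "s = 0"
    then have "area2 x q r = 0" "area2 x r p = 0" using signs by (auto simp: s_def)
    then have "area2 x p q = 0" using area2_barycentric[of x q r p] rx by simp
    then show False using nz \<open>area2 x q r = 0\<close> \<open>area2 x r p = 0\<close> area2_decompose[of p q r x] by simp
  qed
  then have s: "s > 0" using signs by (simp add: s_def)
  \<comment> \<open>The parameter at which the line from \<open>x\<close> through \<open>r\<close>
    meets the segment from \<open>p\<close> to \<open>q\<close>, in the point \<open>m\<close>
    below. Since \<open>area2 p q r = s * (1 - t)\<close>, the orientation only depends on whether
    \<open>m\<close> is met before or after \<open>r\<close>.\<close>
  define t where "t = - area2 x p q / s"
  have area: "area2 p q r = s * (1 - t)"
    using s area2_decompose[of p q r x] by (simp add: t_def s_def field_simps)
  have "t \<noteq> 1" using nz area by auto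
  define m where "m = x + t *\<^sub>R (r - x)"
  have "m = (area2 x q r / s) *\<^sub>R p + (area2 x r p / s) *\<^sub>R q"
  proof -
    have "s *\<^sub>R (m - x) = - (area2 x p q *\<^sub>R (r - x))" using s by (simp add: m_def t_def)
    also have "\<dots> = area2 x q r *\<^sub>R (p - x) + area2 x r p *\<^sub>R (q - x)"
      using area2_barycentric[of x q r p] by (metis eq_neg_iff_add_eq_0)
    also have "\<dots> = area2 x q r *\<^sub>R p + area2 x r p *\<^sub>R q - s *\<^sub>R x"
      by (simp add: s_def algebra_simps)
    finally have "s *\<^sub>R m = area2 x q r *\<^sub>R p + area2 x r p *\<^sub>R q" by (simp add: algebra_simps)
    then have "(1 / s) *\<^sub>R (s *\<^sub>R m) = (1 / s) *\<^sub>R (area2 x q r *\<^sub>R p + area2 x r p *\<^sub>R q)" by simp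
    then show ?thesis using s by (simp add: scaleR_add_right)
  qed
  moreover have "area2 x q r / s + area2 x r p / s = 1" using s by (simp add: s_def add_divide_distrib[symmetric])
  moreover have "p \<in> convex hull S" "q \<in> convex hull S" using assms(2,3) by (auto intro: hull_inc)
  ultimately have m: "m \<in> convex hull S"
    using convexD[OF convex_convex_hull[of S], of p q "area2 x q r / s" "area2 x r p / s"] signs s by simp
  show ?thesis
  proof (cases "t > 1")
    case True
    then have "area2 p q r < 0" using s area by (simp add: mult_less_0_iff)
    then show ?thesis using True m unfolding ccw_area2 far_from_def m_def by auto
  next
    case False
    then have "t < 1" using \<open>t \<noteq> 1\<close> by simp
    then have "area2 p q r > 0" using s area by simp
    moreover have "far_from x S r"
      unfolding far_from_def
    proof (intro allI impI notI)
      fix t' :: real assume t': "t' > 1" and h: "x + t' *\<^sub>R (r - x) \<in> convex hull S"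
      \<comment> \<open>Chosen such that \<open>(1 - u) * t + u * t' = 1\<close>: then
        \<open>r\<close> lies strictly between \<open>m\<close> and the hull point beyond
        \<open>r\<close>, against extremality.\<close>
      define u where "u = (1 - t) / (t' - t)"
      have "0 < u" "u < 1" using \<open>t < 1\<close> t' by (auto simp: u_def)
      moreover have "r = (1 - u) *\<^sub>R m + u *\<^sub>R (x + t' *\<^sub>R (r - x))"
      proof -
        have "(1 - u) * t + u * t' = t + u * (t' - t)" by (simp add: algebra_simps)
        also have "\<dots> = 1" using \<open>t < 1\<close> t' by (simp add: u_def)
        finally have "((1 - u) * t + u * t') *\<^sub>R (r - x) = r - x" by simp
        then show ?thesis by (simp add: m_def algebra_simps)
      qed
      moreover have "m \<noteq> x + t' *\<^sub>R (r - x)" using \<open>t < 1\<close> t' rx by (auto simp: m_def)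
      ultimately have "r \<in> open_segment m (x + t' *\<^sub>R (r - x))" unfolding in_segment by blast
      moreover have "r extreme_point_of convex hull S"
        using assms(1,4) by (simp add: strictly_convex_position_def)
      ultimately show False using m h by (auto simp: extreme_point_of_def)
    qed
    ultimately show ?thesis by (simp add: ccw_area2)
  qed
qed

text \<open>Exchanging \<open>p\<close> and \<open>q\<close> flips the orientation and all three
  signs.\<close>

lemma ccw_iff_not_far_from:
  assumes "strictly_convex_position S" "p \<in> S" "q \<in> S" "r \<in> S" "distinct [p, q, r]" "x \<notin> S"
    and signs: "area2 x q r \<le> 0" "area2 x r p \<le> 0" "area2 x p q \<ge> 0"
  shows "ccw_triangle p q r \<longleftrightarrow> \<not> far_from x S r"
proof -
  have "area2 x p r = - area2 x r p" "area2 x r q = - area2 x q r" "area2 x q p = - area2 x p q"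
    by (simp_all add: area2_def algebra_simps)
  then have "ccw_triangle q p r \<longleftrightarrow> far_from x S r"
    using assms by (intro ccw_iff_far_from) auto
  moreover have "area2 p q r \<noteq> 0" by (rule strictly_convex_area2) (use assms in auto)
  ultimately show ?thesis using area2_swap[of p q r] by (auto simp: ccw_area2)
qed

text \<open>Zero counts as either sign. Thus two points on a common line through \<open>x\<close>
  can be treated like any other pair.\<close>

definition weak_sign :: "bool \<Rightarrow> real \<Rightarrow> bool" where
  "weak_sign b y \<longleftrightarrow> (if b then y \<ge> 0 else y \<le> 0)"

text \<open>The signs belong to the pairs \<open>(1,2)\<close>, \<open>(2,3)\<close>,
  \<open>(3,1)\<close>. If all agree, \<open>x\<close> lies in the triangle and the common sign is
  the orientation. Otherwise the point missing from the pair with the deviating sign is seen between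
  the other two, and its distance bit decides.\<close>

definition orientation_rule :: "bool \<Rightarrow> bool \<Rightarrow> bool \<Rightarrow> bool \<Rightarrow> bool \<Rightarrow> bool \<Rightarrow> bool" where
  "orientation_rule b1 b2 b3 f1 f2 f3 =
    (if b1 = b2 \<and> b2 = b3 then b1 else if b2 = b3 then b2 = f3 else if b3 = b1 then b3 = f1 else b1 = f2)"

text \<open>With equal signs, \<open>area2_decompose\<close> is a sum of terms of one sign.
  Otherwise rotating the triple moves the deviating pair to the first two positions, where one of
  the two preceding lemmas applies.\<close>

lemma ccw_iff_orientation_rule:
  assumes S: "strictly_convex_position S" "p \<in> S" "q \<in> S" "r \<in> S" "distinct [p, q, r]" "x \<notin> S"
    and b: "weak_sign b1 (area2 x p q)" "weak_sign b2 (area2 x q r)" "weak_sign b3 (area2 x r p)"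
  shows "ccw_triangle p q r \<longleftrightarrow> orientation_rule b1 b2 b3 (far_from x S p) (far_from x S q) (far_from x S r)"
proof -
  have nz: "area2 p q r \<noteq> 0" by (rule strictly_convex_area2) (use S in auto)
  have rot: "ccw_triangle p q r \<longleftrightarrow> ccw_triangle q r p" "ccw_triangle p q r \<longleftrightarrow> ccw_triangle r p q"
    using ccw_triangle_rotate by blast+
  note dec = area2_decompose[of p q r x]
  have d: "distinct [q, r, p]" "distinct [r, p, q]" using S(5) by auto
  note r = ccw_iff_far_from[OF S(1-4,5,6)] ccw_iff_not_far_from[OF S(1-4,5,6)]
  note p = ccw_iff_far_from[OF S(1) S(3,4,2) d(1) S(6)] ccw_iff_not_far_from[OF S(1) S(3,4,2) d(1) S(6)]
  note q = ccw_iff_far_from[OF S(1) S(4,2,3) d(2) S(6)] ccw_iff_not_far_from[OF S(1) S(4,2,3) d(2) S(6)]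
  show ?thesis
  proof (cases "b1 = b2 \<and> b2 = b3")
    case True
    then show ?thesis using b nz dec by (cases b1) (auto simp: weak_sign_def orientation_rule_def ccw_area2)
  next
    case False
    then consider "b2 = b3" "b1 \<noteq> b2" | "b3 = b1" "b2 \<noteq> b1" | "b1 = b2" "b3 \<noteq> b1" by blast
    then show ?thesis
    proof cases
      case 1
      then show ?thesis using b r by (cases b2) (auto simp: weak_sign_def orientation_rule_def)
    next
      case 2
      then show ?thesis unfolding rot(1) using b p by (cases b3) (auto simp: weak_sign_def orientation_rule_def)
    next
      case 3
      then show ?thesis unfolding rot(2) using b q by (cases b1) (auto simp: weak_sign_def orientation_rule_def)
    qed
  qed
qed

section \<open>The upper bound for one additional point\<close>

lemma ex_injective_refinement:
  fixes f :: "'p \<Rightarrow> real"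
  assumes "finite V"
  shows "\<exists>pos :: 'p \<Rightarrow> nat. inj_on pos V \<and> (\<forall>a\<in>V. \<forall>b\<in>V. f a < f b \<longrightarrow> pos a < pos b)"
  using assms
proof (induction V rule: finite_ranking_induct[where f = f, consumes 1])
  case empty
  then show ?case by simp
next
  case (insert v S)
  show ?case
  proof (cases "v \<in> S")
    case True
    then show ?thesis using insert.IH by (simp add: insert_absorb)
  next
    case False
    obtain pos :: "'p \<Rightarrow> nat" where pos: "inj_on pos S" "\<And>a b. a \<in> S \<Longrightarrow> b \<in> S \<Longrightarrow> f a < f b \<Longrightarrow> pos a < pos b"
      using insert.IH by blast
    \<comment> \<open>Points arrive by nondecreasing \<open>f\<close> and get a number above all
      earlier ones, so ties are broken by the order of arrival.\<close>
    obtain n where n: "\<And>a. a \<in> S \<Longrightarrow> pos a < n"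
      using finite_imageI[OF insert.hyps(1), of pos] finite_nat_set_iff_bounded by (metis imageI)
    have "inj_on (pos(v := n)) (insert v S)"
    proof -
      have "n \<notin> pos ` S" using n by blast
      then show ?thesis
        using pos(1) False by (auto simp: inj_on_insert fun_upd_image intro: inj_on_fun_updI)
    qed
    moreover have "\<forall>a\<in>insert v S. \<forall>b\<in>insert v S. f a < f b \<longrightarrow> (pos(v := n)) a < (pos(v := n)) b"
      using pos(2) n False insert.hyps(2) by fastforce
    ultimately show ?thesis by blast
  qed
qed

text \<open>A unary label is a type with a mark for the insertion order, or \<open>None\<close> for
  \<open>x\<close>. A binary label holds the types of both ends and whether they lie on a line with
  \<open>x\<close>.\<close>

lemma clique_width_convex_insert:
  assumes "finite S" "strictly_convex_position S" "x \<notin> S"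
  shows "clique_width (insert x S) \<le>
    enat (CARD(((bool \<times> bool) \<times> bool option) option) + 2 * CARD((bool \<times> bool) \<times> (bool \<times> bool) \<times> bool))"
proof -
  \<comment> \<open>A slope such that the line through \<open>x\<close> of slope \<open>c\<close>
    misses \<open>S\<close>. The sign of \<open>h\<close> tells the side of this line;
    \<open>key\<close> is a coordinate for directions from \<open>x\<close> in which opposite
    directions coincide.\<close>
  obtain c where c: "c \<notin> (\<lambda>p. (p $ 2 - x $ 2) / (p $ 1 - x $ 1)) ` S"
    using ex_new_if_finite[OF infinite_UNIV_char_0] assms(1) by blast
  define h where "h p = (p $ 2 - x $ 2) - c * (p $ 1 - x $ 1)" for p :: "real ^ 2"
  define key where "key p = (p $ 1 - x $ 1) / h p" for p :: "real ^ 2"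
  have h: "h p \<noteq> 0" if "p \<in> S" for p
  proof
    assume hp: "h p = 0"
    show False
    proof (cases "p $ 1 = x $ 1")
      case True
      then have "p = x" using hp by (simp add: h_def vec_eq_iff forall_2)
      then show False using that assms(3) by simp
    next
      case False
      then have "c = (p $ 2 - x $ 2) / (p $ 1 - x $ 1)" using hp by (simp add: h_def field_simps)
      then show False using c that by blast
    qed
  qed
  have br: "area2 x p q = h p * h q * (key p - key q)" if "p \<in> S" "q \<in> S" for p q
  proof -
    have "h p * h q * (key p - key q) = h q * (p $ 1 - x $ 1) - h p * (q $ 1 - x $ 1)"
      using h[OF that(1)] h[OF that(2)] by (simp add: key_def field_simps)
    also have "\<dots> = area2 x p q" by (simp add: h_def area2_def algebra_simps)
    finally show ?thesis by simp
  qed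
  obtain pos :: "real ^ 2 \<Rightarrow> nat" where inj: "inj_on pos S"
    and pos: "\<And>a b. a \<in> S \<Longrightarrow> b \<in> S \<Longrightarrow> key a < key b \<Longrightarrow> pos a < pos b"
    using ex_injective_refinement[OF assms(1), of key] by blast
  have key: "key a \<le> key b" if "a \<in> S" "b \<in> S" "pos a < pos b" for a b
    using pos[of b a] that by (meson less_asym not_le)
  \<comment> \<open>By the formula for \<open>area2 x p q\<close>, the sides of two points and the
    order of their keys give the sign of their area with \<open>x\<close>.\<close>
  define ty where "ty p = (h p > 0, far_from x S p)" for p
  have sign: "weak_sign (fst (ty a) \<noteq> fst (ty b)) (area2 x a b)"
    "weak_sign (fst (ty b) = fst (ty a)) (area2 x b a)"
    if "a \<in> S" "b \<in> S" "key a \<le> key b" for a b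
    using h[OF that(1)] h[OF that(2)] that(3)
    by (auto simp: weak_sign_def br that(1,2) ty_def zero_le_mult_iff mult_le_0_iff not_less)
  have less_distinct: "distinct [a, b, c]" if "pos a < pos b" "pos b < pos c" for a b c
    using that by auto
  have "\<exists>u. realizes UNIV UNIV S (\<lambda>p. Some (ty p, Some (p = u)))
    {((a, b), (ty a, ty b, key a = key b)) | a b. a \<in> S \<and> b \<in> S \<and> pos a < pos b} (triples_of ccw_triangle S)"
  proof (rule realizes_ordered[OF assms(1) inj ccw_triangle_rotate, where
      F = "\<lambda>t1 t2 t3. orientation_rule (fst t1 \<noteq> fst t2) (fst t2 \<noteq> fst t3) (fst t3 = fst t1) (snd t1) (snd t2) (snd t3)"])
    fix a b c assume abc: "a \<in> S" "b \<in> S" "c \<in> S"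
    show "ccw_triangle b a c \<longleftrightarrow> \<not> ccw_triangle a b c" if "distinct [a, b, c]"
      using strictly_convex_area2[OF assms(2) abc that] by (auto simp: ccw_area2 area2_swap[of a b])
    assume less: "pos a < pos b" "pos b < pos c"
    have k: "key a \<le> key b" "key b \<le> key c" using key abc less by auto
    note d = less_distinct[OF less]
    have "ccw_triangle a b c = orientation_rule (fst (ty a) \<noteq> fst (ty b)) (fst (ty b) \<noteq> fst (ty c))
      (fst (ty c) = fst (ty a)) (far_from x S a) (far_from x S b) (far_from x S c)"
      by (rule ccw_iff_orientation_rule[OF assms(2) abc d assms(3) sign(1)[OF abc(1,2) k(1)]
            sign(1)[OF abc(2,3) k(2)] sign(2)[OF abc(1,3) order_trans[OF k]]])
    then show "ccw_triangle a b c = orientation_rule (fst (ty a) \<noteq> fst (ty b)) (fst (ty b) \<noteq> fst (ty c))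
      (fst (ty c) = fst (ty a)) (snd (ty a)) (snd (ty b)) (snd (ty c))" by (simp add: ty_def)
    \<comment> \<open>Otherwise all three keys would agree, and three points of \<open>S\<close>
      would lie on one line through \<open>x\<close>. So ties occur only between neighbours in the
      order.\<close>
    show "key a \<noteq> key c"
    proof
      assume "key a = key c"
      then have "key a = key b" "key b = key c" using k by auto
      then have "area2 a b c = 0" using area2_decompose[of a b c x] abc by (simp add: br)
      then show False using strictly_convex_area2[OF assms(2) abc d] by simp
    qed
  qed
  then obtain u where r: "realizes UNIV UNIV S (\<lambda>p. Some (ty p, Some (p = u)))
    {((a, b), (ty a, ty b, key a = key b)) | a b. a \<in> S \<and> b \<in> S \<and> pos a < pos b} (triples_of ccw_triangle S)"
    (is "realizes _ _ _ ?lab ?M _") by blast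
  let ?l = "?lab(x := None)"
  \<comment> \<open>The label \<open>None\<close> has been kept free for \<open>x\<close>. Tied
    pairs are collinear with \<open>x\<close> and give no triple; for the others the sides decide
    the orientation.\<close>
  define X :: "bool \<Rightarrow> (((bool \<times> bool) \<times> bool option) option \<times> (bool \<times> bool) \<times> (bool \<times> bool) \<times> bool) set"
    where "X b = {(l, t1, t2, d). l = None \<and> \<not> d \<and> (fst t1 \<noteq> fst t2) = b}" for b
  have Mk: "(\<exists>k. (?l c, k) \<in> X f \<and> ((a, b), k) \<in> ?M) \<longleftrightarrow>
      c = x \<and> a \<in> S \<and> b \<in> S \<and> pos a < pos b \<and> key a \<noteq> key b \<and> (fst (ty a) \<noteq> fst (ty b)) = f" for a b c f
  proof -
    have "((a, b), k) \<in> ?M \<longleftrightarrow> k = (ty a, ty b, key a = key b) \<and> a \<in> S \<and> b \<in> S \<and> pos a < pos b" for k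
      by auto
    moreover have "(?l c, ty a, ty b, d) \<in> X f \<longleftrightarrow> c = x \<and> \<not> d \<and> (fst (ty a) \<noteq> fst (ty b)) = f" for d
      unfolding X_def by simp
    ultimately show ?thesis by (simp only: simp_thms ex_simps conj_ac)
  qed
  have ccw_x: "ccw_triangle a b x \<longleftrightarrow> key a \<noteq> key b \<and> fst (ty a) \<noteq> fst (ty b)"
      "ccw_triangle b a x \<longleftrightarrow> key a \<noteq> key b \<and> fst (ty a) = fst (ty b)"
    if "a \<in> S" "b \<in> S" "pos a < pos b" for a b
    using key[OF that] h[OF that(1)] h[OF that(2)]
    by (auto simp: ccw_area2 area2_rotate[of a b x] area2_rotate[of b a x] br that(1,2) ty_def zero_less_mult_iff
        mult_less_0_iff not_less)
  have "realizes UNIV UNIV (insert x S) ?l ?M (triples_of ccw_triangle S)"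
    by (rule realizes_insert) (use r assms(3) in auto)
  note r2 = realizes_UN_add_reversed_triples[OF _ realizes_UN_add_triples[OF _ this, of "X True"], of "X False"]
  have "realizes UNIV UNIV (insert x S) ?l ?M (order_type (insert x S))"
    unfolding order_type_eq
  proof (rule realizes_cong[OF r2 refl refl])
    show "triples_of ccw_triangle S \<union>
      \<Union>{cyclic_closure (a, b, c) | a b c. distinct [a, b, c] \<and> c \<in> insert x S \<and>
          (\<exists>k. (?l c, k) \<in> X True \<and> ((a, b), k) \<in> ?M)} \<union>
      \<Union>{cyclic_closure (b, a, c) | a b c. distinct [a, b, c] \<and> c \<in> insert x S \<and>
          (\<exists>k. (?l c, k) \<in> X False \<and> ((a, b), k) \<in> ?M)} = triples_of ccw_triangle (insert x S)"
        (is "_ \<union> ?L1 \<union> ?L2 = _")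
    proof -
      have "?L1 \<union> ?L2 = \<Union>{cyclic_closure (a, b, x) | a b. a \<in> S \<and> b \<in> S \<and> a \<noteq> b \<and> ccw_triangle a b x}"
        (is "_ = ?R")
      proof
        have "?L1 \<subseteq> ?R" unfolding Mk
        proof (rule Union_least, elim CollectE exE conjE)
          fix y a b c assume "y = cyclic_closure (a, b, c)" "c = x" "distinct [a, b, c]"
            "a \<in> S" "b \<in> S" "pos a < pos b" "key a \<noteq> key b" "(fst (ty a) \<noteq> fst (ty b)) = True"
          moreover from this have "ccw_triangle a b x" using ccw_x(1)[of a b] by simp
          moreover have "a \<noteq> b" using calculation by auto
          ultimately show "y \<subseteq> ?R" by blast
        qed
        moreover have "?L2 \<subseteq> ?R" unfolding Mk
        proof (rule Union_least, elim CollectE exE conjE)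
          fix y a b c assume "y = cyclic_closure (b, a, c)" "c = x" "distinct [a, b, c]"
            "a \<in> S" "b \<in> S" "pos a < pos b" "key a \<noteq> key b" "(fst (ty a) \<noteq> fst (ty b)) = False"
          moreover from this have "ccw_triangle b a x" using ccw_x(2)[of a b] by simp
          moreover have "b \<noteq> a" using calculation by auto
          ultimately show "y \<subseteq> ?R" by blast
        qed
        ultimately show "?L1 \<union> ?L2 \<subseteq> ?R" by (rule Un_least)
        have "cyclic_closure (a, b, x) \<subseteq> ?L1 \<union> ?L2" if ab: "a \<in> S" "b \<in> S" "a \<noteq> b" "ccw_triangle a b x" for a b
        proof -
          have d: "distinct [a, b, x]" "distinct [b, a, x]" using ab assms(3) by auto
          have "pos a \<noteq> pos b" using ab inj_onD[OF inj, of a b] by blast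
          then consider "pos a < pos b" | "pos b < pos a" by linarith
          then show ?thesis
          proof cases
            case 1
            then have "cyclic_closure (a, b, x) \<subseteq> ?L1"
              unfolding Mk using ccw_x(1)[of a b] ab d(1) by blast
            then show ?thesis by (rule le_supI1)
          next
            case 2
            then have "cyclic_closure (a, b, x) \<subseteq> ?L2"
              unfolding Mk using ccw_x(2)[of b a] ab d(2) by blast
            then show ?thesis by (rule le_supI2)
          qed
        qed
        then show "?R \<subseteq> ?L1 \<union> ?L2"
          by (intro Union_least) (elim CollectE exE conjE, simp only:)
      qed
      then show ?thesis
        using triples_of_insert[of ccw_triangle x S, OF ccw_triangle_rotate assms(3)] by (simp only: Un_assoc)
    qed
  qed simp_all
  then show ?thesis
    unfolding clique_width_def by (rule structure_clique_width_le) simp_all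
qed

lemma strictly_convex_position_subset:
  assumes "strictly_convex_position S" "T \<subseteq> S"
  shows "strictly_convex_position T"
  using assms hull_mono[of T S convex] unfolding strictly_convex_position_def extreme_point_of_def
  by (meson hull_inc subsetD)

lemma clique_width_convex:
  assumes "finite P" "P0 \<subseteq> P" "strictly_convex_position P0" "card (P - P0) \<le> 1"
  shows "clique_width P \<le>
    enat (CARD(((bool \<times> bool) \<times> bool option) option) + 2 * CARD((bool \<times> bool) \<times> (bool \<times> bool) \<times> bool))"
proof (cases "P = {}")
  case True
  then show ?thesis by (simp add: clique_width_def structure_clique_width_def)
next
  case False
  \<comment> \<open>If \<open>P = P0\<close>, any point may take the part of the additional one, as
    convex position is inherited by subsets.\<close>
  obtain x where x: "x \<in> P" "P - {x} \<subseteq> P0"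
  proof (cases "P = P0")
    case True
    then show ?thesis using False that by blast
  next
    case False
    then obtain x where x: "x \<in> P - P0" using assms(2) by blast
    have "P - P0 = {x}"
      using x assms(1,4) card_le_Suc0_iff_eq[of "P - P0"] by auto
    then show ?thesis using that[of x] x by blast
  qed
  have "strictly_convex_position (P - {x})"
    by (rule strictly_convex_position_subset[OF assms(3) x(2)])
  then have "clique_width (insert x (P - {x})) \<le>
    enat (CARD(((bool \<times> bool) \<times> bool option) option) + 2 * CARD((bool \<times> bool) \<times> (bool \<times> bool) \<times> bool))"
    by (intro clique_width_convex_insert) (use assms(1) in auto)
  then show ?thesis using x(1) by (simp only: insert_Diff)
qed

section \<open>Convex position and two more points\<close>

primrec subexprs :: "('p, 'u, 'b) cw_expr \<Rightarrow> ('p, 'u, 'b) cw_expr set" where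
  "subexprs (New_Point p i) = {New_Point p i}"
| "subexprs (Disjoint_Union e f) = insert (Disjoint_Union e f) (subexprs e \<union> subexprs f)"
| "subexprs (Label_Pairs i j k e) = insert (Label_Pairs i j k e) (subexprs e)"
| "subexprs (Add_Triples i k e) = insert (Add_Triples i k e) (subexprs e)"
| "subexprs (Add_Reversed_Triples i k e) = insert (Add_Reversed_Triples i k e) (subexprs e)"
| "subexprs (Relabel_Unary i j e) = insert (Relabel_Unary i j e) (subexprs e)"
| "subexprs (Relabel_Binary i j e) = insert (Relabel_Binary i j e) (subexprs e)"

lemma subexprs_subset:
  "f \<in> subexprs e \<Longrightarrow> points f \<subseteq> points e \<and> unary_labels f \<subseteq> unary_labels e \<and> binary_labels f \<subseteq> binary_labels e"
  by (induction e) (force split: if_splits)+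

lemma finite_expr_sets: "finite (points e)" "finite (unary_labels e)" "finite (binary_labels e)"
  by (induction e) auto

text \<open>Descend from the root while more than \<open>2 * t\<close> points of \<open>W\<close>
  remain. At a disjoint union one side then keeps more than \<open>t\<close>, and other operations
  do not change the points.\<close>

lemma ex_balanced_subexpr:
  assumes "t < card (points e \<inter> W)" "t > 0"
  shows "\<exists>f\<in>subexprs e. t < card (points f \<inter> W) \<and> card (points f \<inter> W) \<le> 2 * t"
  using assms(1)
proof (induction e)
  case (New_Point p i)
  have "card ({p} \<inter> W) \<le> card {p}" by (intro card_mono) auto
  with New_Point assms(2) show ?case by simp
next
  case (Disjoint_Union e f)
  show ?case
  proof (cases "card (points (Disjoint_Union e f) \<inter> W) \<le> 2 * t")
    case False
    have "card (points (Disjoint_Union e f) \<inter> W) \<le> card (points e \<inter> W) + card (points f \<inter> W)"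
      using card_Un_le[of "points e \<inter> W" "points f \<inter> W"] by (simp add: Int_Un_distrib2)
    with False have "t < card (points e \<inter> W) \<or> t < card (points f \<inter> W)" by linarith
    then show ?thesis using Disjoint_Union.IH by auto
  qed (use Disjoint_Union.prems in auto)
qed auto

lemma triples_Add_Triples_iff:
  "(x, y, w) \<in> triples (Add_Triples i k e) \<longleftrightarrow> (x, y, w) \<in> triples e \<or> distinct [x, y, w] \<and>
     ((w, i) \<in> point_labelling e \<and> ((x, y), k) \<in> pair_labelling e \<or>
      (y, i) \<in> point_labelling e \<and> ((w, x), k) \<in> pair_labelling e \<or>
      (x, i) \<in> point_labelling e \<and> ((y, w), k) \<in> pair_labelling e)" (is "?l \<longleftrightarrow> ?r")
proof
  show "?l \<Longrightarrow> ?r" by (auto simp: cyclic_closure_def)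
  have "(x, y, w) \<in> cyclic_closure (x, y, w)" "(x, y, w) \<in> cyclic_closure (w, x, y)"
    "(x, y, w) \<in> cyclic_closure (y, w, x)" by (auto simp: cyclic_closure_def)
  then show "?r \<Longrightarrow> ?l" by simp blast
qed

lemma triples_Add_Reversed_Triples_iff:
  "(x, y, w) \<in> triples (Add_Reversed_Triples i k e) \<longleftrightarrow> (x, y, w) \<in> triples e \<or> distinct [x, y, w] \<and>
     ((w, i) \<in> point_labelling e \<and> ((y, x), k) \<in> pair_labelling e \<or>
      (y, i) \<in> point_labelling e \<and> ((x, w), k) \<in> pair_labelling e \<or>
      (x, i) \<in> point_labelling e \<and> ((w, y), k) \<in> pair_labelling e)" (is "?l \<longleftrightarrow> ?r")
proof
  show "?l \<Longrightarrow> ?r" by (auto simp: cyclic_closure_def)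
  have "(x, y, w) \<in> cyclic_closure (x, y, w)" "(x, y, w) \<in> cyclic_closure (w, x, y)"
    "(x, y, w) \<in> cyclic_closure (y, w, x)" by (auto simp: cyclic_closure_def)
  then show "?r \<Longrightarrow> ?l" by simp blast
qed

lemma points_of_triples:
  "(x, y, w) \<in> triples e \<Longrightarrow> x \<in> points e \<and> y \<in> points e \<and> w \<in> points e"
proof (induction e)
  case (Add_Triples i k e)
  then show ?case unfolding triples_Add_Triples_iff
    by (auto dest: labels_of_labelling labels_of_pair_labelling)
next
  case (Add_Reversed_Triples i k e)
  then show ?case unfolding triples_Add_Reversed_Triples_iff
    by (auto dest: labels_of_labelling labels_of_pair_labelling)
qed auto

text \<open>If \<^term>\<open>z\<close> is not created by \<^term>\<open>f\<close>, the hypotheses on pairs hold trivially.\<close>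

lemma same_labels_same_triples:
  assumes "f \<in> subexprs e" "valid_expr e" "a \<in> points f" "a' \<in> points f" "a \<noteq> z" "a' \<noteq> z"
    and "\<And>i. (a, i) \<in> point_labelling f \<longleftrightarrow> (a', i) \<in> point_labelling f"
    and "\<And>k. ((z, a), k) \<in> pair_labelling f \<longleftrightarrow> ((z, a'), k) \<in> pair_labelling f"
    and "\<And>k. ((a, z), k) \<in> pair_labelling f \<longleftrightarrow> ((a', z), k) \<in> pair_labelling f"
    and "c \<notin> points f" "c \<noteq> z"
  shows "(z, a, c) \<in> triples e \<longleftrightarrow> (z, a', c) \<in> triples e"
proof -
  \<comment> \<open>An invariant of all operations applied after \<open>f\<close>. Pairs with
    \<open>c\<close> are included because the triple may be added through any of its three pairs;
    \<open>(c, z)\<close> involves neither \<open>a\<close> nor \<open>a'\<close>.\<close>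
  define twins where "twins g \<longleftrightarrow>
    (\<forall>i. (a, i) \<in> point_labelling g \<longleftrightarrow> (a', i) \<in> point_labelling g) \<and>
    (\<forall>q k. q = z \<or> q = c \<longrightarrow> (((q, a), k) \<in> pair_labelling g \<longleftrightarrow> ((q, a'), k) \<in> pair_labelling g) \<and>
       (((a, q), k) \<in> pair_labelling g \<longleftrightarrow> ((a', q), k) \<in> pair_labelling g)) \<and>
    ((z, a, c) \<in> triples g \<longleftrightarrow> (z, a', c) \<in> triples g)" for g :: "('a, 'b, 'c) cw_expr"
  have base: "twins f"
  proof -
    have "((q, c), k) \<notin> pair_labelling f" "((c, q), k) \<notin> pair_labelling f" for q k
      using labels_of_pair_labelling[of q c k f] labels_of_pair_labelling[of c q k f] assms(10) by auto
    moreover have "(z, q, c) \<notin> triples f" for q using points_of_triples[of z q c f] assms(10) by auto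
    ultimately show ?thesis using assms(7-9) unfolding twins_def by auto
  qed
  have ca: "c \<noteq> a" "c \<noteq> a'" using assms by auto
  have "twins e" using assms(1,2)
  proof (induction e)
    case (New_Point p i)
    then show ?case using base by simp
  next
    case (Disjoint_Union e1 e2)
    \<comment> \<open>The other side of the union creates neither \<open>a\<close> nor
      \<open>a'\<close>, so it contributes nothing to either.\<close>
    have union: "twins (Disjoint_Union g h)" "twins (Disjoint_Union h g)"
      if "twins g" "f \<in> subexprs g" "points g \<inter> points h = {}" for g h
    proof -
      have "a \<notin> points h" "a' \<notin> points h" using subexprs_subset[OF that(2)] that(3) assms(3,4) by auto
      then have "(a, i) \<notin> point_labelling h" "(a', i) \<notin> point_labelling h"
        "((q, a), k) \<notin> pair_labelling h" "((q, a'), k) \<notin> pair_labelling h"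
        "((a, q), k) \<notin> pair_labelling h" "((a', q), k) \<notin> pair_labelling h"
        "(z, a, c) \<notin> triples h" "(z, a', c) \<notin> triples h" for i q k
        using labels_of_labelling[of _ i h] labels_of_pair_labelling[of _ _ k h] points_of_triples[of z _ c h]
        by blast+
      then show "twins (Disjoint_Union g h)" "twins (Disjoint_Union h g)"
        using that(1) unfolding twins_def by simp_all
    qed
    consider "f = Disjoint_Union e1 e2" | "f \<in> subexprs e1" | "f \<in> subexprs e2"
      using Disjoint_Union.prems by auto
    then show ?case
    proof cases
      case 1 then show ?thesis using base by simp
    next
      case 2 then show ?thesis using union(1)[of e1 e2] Disjoint_Union by simp
    next
      case 3 then show ?thesis using union(2)[of e2 e1] Disjoint_Union by (simp add: Int_commute)
    qed
  next
    case (Label_Pairs i j k e)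
    show ?case
    proof (cases "f = Label_Pairs i j k e")
      case False
      then have "twins e" using Label_Pairs by auto
      then show ?thesis unfolding twins_def by auto
    qed (use base in simp)
  next
    case (Add_Triples i k e)
    show ?case
    proof (cases "f = Add_Triples i k e")
      case False
      then have "twins e" using Add_Triples by auto
      then show ?thesis using ca assms(5,6,11)
        unfolding twins_def triples_Add_Triples_iff by auto
    qed (use base in simp)
  next
    case (Add_Reversed_Triples i k e)
    show ?case
    proof (cases "f = Add_Reversed_Triples i k e")
      case False
      then have "twins e" using Add_Reversed_Triples by auto
      then show ?thesis using ca assms(5,6,11)
        unfolding twins_def triples_Add_Reversed_Triples_iff by auto
    qed (use base in simp)
  next
    case (Relabel_Unary i j e)
    show ?case
    proof (cases "f = Relabel_Unary i j e")
      case False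
      then have "twins e" using Relabel_Unary by auto
      then show ?thesis unfolding twins_def by auto
    qed (use base in simp)
  next
    case (Relabel_Binary i j e)
    show ?case
    proof (cases "f = Relabel_Binary i j e")
      case False
      then have "twins e" using Relabel_Binary by auto
      then show ?thesis unfolding twins_def by auto
    qed (use base in simp)
  qed
  then show ?thesis by (simp add: twins_def)
qed

text \<open>Separated points must differ in their own labels or in the labels of their pairs with
  \<open>z\<close>. The width counts binary labels twice, which matches the two directions of such
  pairs: there are \<open>2 ^ width e\<close> possible types.\<close>

lemma card_separated_le:
  assumes "valid_expr e" "f \<in> subexprs e"
    and inside: "\<And>i. i \<in> I \<Longrightarrow> a i \<in> points f \<and> a i \<noteq> z"
    and separated: "\<And>i j. i \<in> I \<Longrightarrow> j \<in> I \<Longrightarrow> i < j \<Longrightarrow>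
      \<exists>c. c \<notin> points f \<and> c \<noteq> z \<and> ((z, a i, c) \<in> triples e) \<noteq> ((z, a j, c) \<in> triples e)"
  shows "card (I :: nat set) \<le> 2 ^ width e"
proof -
  define type where "type p = ({i. (p, i) \<in> point_labelling f},
    {k. ((z, p), k) \<in> pair_labelling f}, {k. ((p, z), k) \<in> pair_labelling f})" for p
  let ?T = "Pow (unary_labels e) \<times> Pow (binary_labels e) \<times> Pow (binary_labels e)"
  have "type (a i) \<noteq> type (a j)" if ij: "i \<in> I" "j \<in> I" "i < j" for i j
  proof
    assume "type (a i) = type (a j)"
    then have eq: "\<And>l. (a i, l) \<in> point_labelling f \<longleftrightarrow> (a j, l) \<in> point_labelling f"
      "\<And>k. ((z, a i), k) \<in> pair_labelling f \<longleftrightarrow> ((z, a j), k) \<in> pair_labelling f"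
      "\<And>k. ((a i, z), k) \<in> pair_labelling f \<longleftrightarrow> ((a j, z), k) \<in> pair_labelling f"
      by (auto simp: type_def)
    obtain c where "c \<notin> points f" "c \<noteq> z" "((z, a i, c) \<in> triples e) \<noteq> ((z, a j, c) \<in> triples e)"
      using separated[OF ij] by blast
    then show False
      using same_labels_same_triples[OF assms(2,1), of "a i" "a j" z c] inside ij eq by blast
  qed
  then have "inj_on (\<lambda>i. type (a i)) I"
    by (intro inj_onI) (metis linorder_neqE_nat)
  moreover have "(\<lambda>i. type (a i)) ` I \<subseteq> ?T"
    using subexprs_subset[OF assms(2)] labels_of_labelling[of _ _ f] labels_of_pair_labelling[of _ _ _ f]
    unfolding type_def by blast
  ultimately have "card I \<le> card ?T"
    by (rule card_inj_on_le) (simp add: finite_expr_sets)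
  also have "\<dots> = 2 ^ width e"
    by (simp add: card_cartesian_product card_Pow finite_expr_sets width_def power_add power_mult power2_eq_square
        power_mult_distrib[symmetric])
  finally show ?thesis .
qed

section \<open>Sets with few changes and the bound on the width\<close>

text \<open>The numbers below \<^term>\<open>m * m\<close> form a grid with \<^term>\<open>m\<close> rows and \<^term>\<open>m\<close> columns.
  Few changes leave some row and some column constant, and these constants agree.\<close>

lemma grid_few_changes:
  fixes B :: "nat \<Rightarrow> bool"
  assumes rows: "card {s. s + 1 < m * m \<and> B s \<noteq> B (s + 1)} \<le> p" "p < m"
    and cols: "card {s. s + m < m * m \<and> B s \<noteq> B (s + m)} \<le> q" "q < m"
  shows "\<exists>v. card {s. s < m * m \<and> B s \<noteq> v} \<le> p * q"
proof -
  \<comment> \<open>The rows and columns in which a change starts. A change from the end of a row to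
    the next row is counted in the former.\<close>
  define R where "R = (\<lambda>s. s div m) ` {s. s + 1 < m * m \<and> B s \<noteq> B (s + 1)}"
  define C where "C = (\<lambda>s. s mod m) ` {s. s + m < m * m \<and> B s \<noteq> B (s + m)}"
  have fin: "finite {s. s + 1 < m * m \<and> B s \<noteq> B (s + 1)}" "finite {s. s + m < m * m \<and> B s \<noteq> B (s + m)}"
    by (rule finite_subset[of _ "{..<m * m}"], auto)+
  have "card R \<le> p" unfolding R_def using card_image_le[OF fin(1)] rows(1) order_trans by blast
  have "card C \<le> q" unfolding C_def using card_image_le[OF fin(2)] cols(1) order_trans by blast
  have finRC: "finite R" "finite C" unfolding R_def C_def using fin by auto
  have lt: "j * m + i < m * m" if "j < m" "i < m" for i j
  proof -
    have "j * m + i < Suc j * m" using that by simp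
    also have "\<dots> \<le> m * m" using that by (intro mult_le_mono1) simp
    finally show ?thesis .
  qed
  have row: "B (j * m + i) = B (j * m)" if "j < m" "j \<notin> R" "i < m" for i j
    using that(3)
  proof (induction i)
    case (Suc i)
    have "j * m + i + 1 < m * m" using lt[OF that(1) Suc.prems] by simp
    moreover have "(j * m + i) div m = j" using Suc.prems by simp
    ultimately have "B (j * m + i) = B (j * m + i + 1)"
      using that(2) imageI[of "j * m + i" "{s. s + 1 < m * m \<and> B s \<noteq> B (s + 1)}" "\<lambda>s. s div m"]
      unfolding R_def by auto
    then show ?case using Suc by simp
  qed simp
  have col: "B (j * m + r) = B r" if "j < m" "r < m" "r \<notin> C" for j r
    using that(1)
  proof (induction j)
    case (Suc j)
    have "j * m + r + m < m * m" using lt[OF Suc.prems that(2)] by (simp add: algebra_simps)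
    moreover have "(j * m + r) mod m = r" using that(2) by simp
    ultimately have "B (j * m + r) = B (j * m + r + m)"
      using that(3) imageI[of "j * m + r" "{s. s + m < m * m \<and> B s \<noteq> B (s + m)}" "\<lambda>s. s mod m"]
      unfolding C_def by auto
    then show ?case using Suc by (simp add: algebra_simps)
  qed simp
  have "\<not> {..<m} \<subseteq> R" using card_mono[OF finRC(1), of "{..<m}"] \<open>card R \<le> p\<close> rows(2) by auto
  then obtain j0 where j0: "j0 < m" "j0 \<notin> R" by auto
  have "\<not> {..<m} \<subseteq> C" using card_mono[OF finRC(2), of "{..<m}"] \<open>card C \<le> q\<close> cols(2) by auto
  then obtain r0 where r0: "r0 < m" "r0 \<notin> C" by auto
  define v where "v = B (j0 * m + r0)"
  \<comment> \<open>From \<open>s\<close> to the crossing of row \<open>j0\<close> and column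
    \<open>r0\<close> one can go along the row of \<open>s\<close> and then column
    \<open>r0\<close>, or along the column of \<open>s\<close> and then row \<open>j0\<close>. Both
    ways must be blocked for an exceptional \<open>s\<close>.\<close>
  have bad: "s div m \<in> R \<and> s mod m \<in> C" if "s < m * m" "B s \<noteq> v" for s
  proof -
    define j r where "j = s div m" and "r = s mod m"
    have s: "s = j * m + r" "j < m" "r < m"
      using that(1) j0(1) by (auto simp: j_def r_def less_mult_imp_div_less)
    have "j \<in> R"
    proof (rule ccontr)
      assume "j \<notin> R"
      then have "B s = B (j * m + r0)" using row[OF s(2)] s r0 by simp
      also have "\<dots> = v" unfolding v_def using col s(2) r0 j0 by simp
      finally show False using that(2) by simp
    qed
    moreover have "r \<in> C"
    proof (rule ccontr)
      assume "r \<notin> C"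
      then have "B s = B (j0 * m + r)" using col s j0 by simp
      also have "\<dots> = v" unfolding v_def using row[OF j0] s(3) r0 by simp
      finally show False using that(2) by simp
    qed
    ultimately show ?thesis by (simp add: j_def r_def)
  qed
  have "inj_on (\<lambda>s. (s div m, s mod m)) {s. s < m * m \<and> B s \<noteq> v}"
    by (rule inj_onI) (metis Pair_inject div_mult_mod_eq)
  moreover have "(\<lambda>s. (s div m, s mod m)) ` {s. s < m * m \<and> B s \<noteq> v} \<subseteq> R \<times> C" using bad by auto
  ultimately have "card {s. s < m * m \<and> B s \<noteq> v} \<le> card (R \<times> C)"
    by (rule card_inj_on_le) (use finRC in simp)
  also have "\<dots> \<le> p * q" using \<open>card R \<le> p\<close> \<open>card C \<le> q\<close> by (simp add: card_cartesian_product mult_le_mono)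
  finally show ?thesis by blast
qed

text \<open>Let \<open>A\<close> be the points of a subexpression. Around \<open>x\<close>, few
  changes mean that \<open>l s\<close> and \<open>l (s + 1)\<close>, and also \<open>l s\<close> and
  \<open>u s\<close>, rarely disagree about \<open>A\<close>; around \<open>y\<close> the same holds
  for \<open>u s\<close> and \<open>l (s + m)\<close>. Passing through \<open>u s\<close> bounds the
  changes from \<open>l s\<close> to \<open>l (s + m)\<close>, that is, along columns.\<close>

lemma width_shifted_orders:
  fixes l u :: "nat \<Rightarrow> 'p" and m n :: nat
  defines "m \<equiv> 5 * 2 ^ n + 1"
  assumes "valid_expr e" "inj_on l {..<m * m}" "l ` {..<m * m} \<subseteq> points e"
    and ne: "\<And>s. s < m * m \<Longrightarrow> l s \<noteq> x \<and> l s \<noteq> y \<and> u s \<noteq> x \<and> u s \<noteq> y"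
    and xll: "\<And>s t. s < m * m \<Longrightarrow> t < m * m \<Longrightarrow> (x, l s, l t) \<in> triples e \<longleftrightarrow> t < s"
    and xlu: "\<And>s t. s < m * m \<Longrightarrow> t < m * m \<Longrightarrow> (x, l s, u t) \<in> triples e \<longleftrightarrow> t < s"
    and xul: "\<And>s t. s < m * m \<Longrightarrow> t < m * m \<Longrightarrow> (x, u t, l s) \<in> triples e \<longleftrightarrow> s \<le> t"
    and ylu: "\<And>s t. s < m * m \<Longrightarrow> t < m * m \<Longrightarrow> (y, l s, u t) \<in> triples e \<longleftrightarrow> t + m < s"
    and yul: "\<And>s t. s < m * m \<Longrightarrow> t < m * m \<Longrightarrow> (y, u t, l s) \<in> triples e \<longleftrightarrow> s \<le> t + m"
  shows "width e > n"
proof (rule ccontr)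
  assume "\<not> width e > n"
  then have w: "2 ^ width e \<le> (2 :: nat) ^ n" by (intro power_increasing) auto
  define K :: nat where "K = 2 ^ n"
  have K: "K > 0" by (simp add: K_def)
  let ?W = "l ` {..<m * m}"
  have W: "card ?W = m * m" using assms(3) by (simp add: card_image)
  have m: "m = 5 * K + 1" by (simp add: m_def K_def)
  \<comment> \<open>Rows and columns will have at most \<open>2 * K\<close> and \<open>4 * K\<close>
    changes, both below \<open>m\<close>, leaving at most \<open>8 * K * K\<close> exceptions. A
    part of size above \<open>8 * K * K\<close> and at most \<open>16 * K * K\<close> is then
    neither almost empty nor almost everything, as \<open>m * m\<close> exceeds the sum of 8 and 16
    times \<open>K * K\<close>.\<close>
  have mm: "m * m > 24 * (K * K)" by (simp add: m)
  have "points e \<inter> ?W = ?W" using assms(4) by blast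
  then have "8 * (K * K) < card (points e \<inter> ?W)" using W mm by simp
  from ex_balanced_subexpr[OF this] K obtain f where f: "f \<in> subexprs e"
    and bal: "8 * (K * K) < card (points f \<inter> ?W)" "card (points f \<inter> ?W) \<le> 2 * (8 * (K * K))" by auto
  define A where "A = points f"
  have sep: "card I \<le> K"
    if "\<And>i. i \<in> I \<Longrightarrow> a i \<in> A \<and> a i \<noteq> z"
      "\<And>i j. i \<in> I \<Longrightarrow> j \<in> I \<Longrightarrow> i < j \<Longrightarrow>
        \<exists>c. c \<notin> A \<and> c \<noteq> z \<and> ((z, a i, c) \<in> triples e) \<noteq> ((z, a j, c) \<in> triples e)"
    for I :: "nat set" and a z
    using order_trans[OF card_separated_le[OF assms(2) f that[unfolded A_def]] w] by (simp add: K_def)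
  let ?R1 = "{s. s + 1 < m * m \<and> l s \<in> A \<and> l (s + 1) \<notin> A}"
  let ?R2 = "{s. s + 1 < m * m \<and> l s \<notin> A \<and> l (s + 1) \<in> A}"
  let ?C1 = "{s. s + m < m * m \<and> l s \<in> A \<and> u s \<notin> A}"
  let ?C2 = "{s. s + m < m * m \<and> l s \<notin> A \<and> u s \<in> A}"
  let ?C3 = "{s. s + m < m * m \<and> l (s + m) \<in> A \<and> u s \<notin> A}"
  let ?C4 = "{s. s + m < m * m \<and> l (s + m) \<notin> A \<and> u s \<in> A}"
  have "card ?R1 \<le> K"
  proof (rule sep[where a = l and z = x])
    fix i j assume ij: "i \<in> ?R1" "j \<in> ?R1" "i < j"
    \<comment> \<open>\<open>l j\<close> is in \<open>A\<close> and \<open>l (i + 1)\<close> is not,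
      so the latter lies strictly before \<open>l j\<close> in the order around \<open>x\<close> and
      separates it from \<open>l i\<close>.\<close>
    then have "i + 1 \<noteq> j" by auto
    then show "\<exists>c. c \<notin> A \<and> c \<noteq> x \<and> ((x, l i, c) \<in> triples e) \<noteq> ((x, l j, c) \<in> triples e)"
      using ij ne xll by (intro exI[of _ "l (i + 1)"]) auto
  qed (use ne in auto)
  moreover have "card ?R2 \<le> K"
  proof (rule sep[where a = "\<lambda>s. l (s + 1)" and z = x])
    fix i j assume ij: "i \<in> ?R2" "j \<in> ?R2" "i < j"
    then have "i + 1 \<noteq> j" by auto
    then show "\<exists>c. c \<notin> A \<and> c \<noteq> x \<and> ((x, l (i + 1), c) \<in> triples e) \<noteq> ((x, l (j + 1), c) \<in> triples e)"
      using ij ne xll by (intro exI[of _ "l j"]) auto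
  qed (use ne in auto)
  moreover have "card {s. s + 1 < m * m \<and> (l s \<in> A) \<noteq> (l (s + 1) \<in> A)} \<le> card ?R1 + card ?R2"
    by (rule order_trans[OF _ card_Un_le], rule card_mono, rule finite_subset[of _ "{..<m * m}"]) auto
  ultimately have rows: "card {s. s + 1 < m * m \<and> (l s \<in> A) \<noteq> (l (s + 1) \<in> A)} \<le> 2 * K" by simp
  have "card ?C1 \<le> K"
  proof (rule sep[where a = l and z = x])
    fix i j assume ij: "i \<in> ?C1" "j \<in> ?C1" "i < j"
    then show "\<exists>c. c \<notin> A \<and> c \<noteq> x \<and> ((x, l i, c) \<in> triples e) \<noteq> ((x, l j, c) \<in> triples e)"
      using ne xlu by (intro exI[of _ "u i"]) auto
  qed (use ne in auto)
  moreover have "card ?C2 \<le> K"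
  proof (rule sep[where a = u and z = x])
    fix i j assume ij: "i \<in> ?C2" "j \<in> ?C2" "i < j"
    then show "\<exists>c. c \<notin> A \<and> c \<noteq> x \<and> ((x, u i, c) \<in> triples e) \<noteq> ((x, u j, c) \<in> triples e)"
      using ne xul by (intro exI[of _ "l j"]) auto
  qed (use ne in auto)
  moreover have "card ?C3 \<le> K"
  proof (rule sep[where a = "\<lambda>s. l (s + m)" and z = y])
    fix i j assume ij: "i \<in> ?C3" "j \<in> ?C3" "i < j"
    then show "\<exists>c. c \<notin> A \<and> c \<noteq> y \<and> ((y, l (i + m), c) \<in> triples e) \<noteq> ((y, l (j + m), c) \<in> triples e)"
      using ne ylu by (intro exI[of _ "u i"]) auto
  qed (use ne in auto)
  moreover have "card ?C4 \<le> K"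
  proof (rule sep[where a = u and z = y])
    fix i j assume ij: "i \<in> ?C4" "j \<in> ?C4" "i < j"
    then show "\<exists>c. c \<notin> A \<and> c \<noteq> y \<and> ((y, u i, c) \<in> triples e) \<noteq> ((y, u j, c) \<in> triples e)"
      using ne yul by (intro exI[of _ "l (j + m)"]) auto
  qed (use ne in auto)
  moreover have "card {s. s + m < m * m \<and> (l s \<in> A) \<noteq> (l (s + m) \<in> A)} \<le>
      card (?C1 \<union> ?C2 \<union> ?C3 \<union> ?C4)"
    by (rule card_mono, rule finite_subset[of _ "{..<m * m}"]) auto
  moreover have "card (?C1 \<union> ?C2 \<union> ?C3 \<union> ?C4) \<le> card ?C1 + card ?C2 + card ?C3 + card ?C4"
    by (meson card_Un_le add_le_mono order_trans le_refl)
  ultimately have cols: "card {s. s + m < m * m \<and> (l s \<in> A) \<noteq> (l (s + m) \<in> A)} \<le> 4 * K" by linarith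
  obtain v where v: "card {s. s < m * m \<and> (l s \<in> A) \<noteq> v} \<le> (2 * K) * (4 * K)"
    using grid_few_changes[OF rows _ cols] m by auto
  have "A \<inter> ?W = l ` {s. s < m * m \<and> l s \<in> A}" by auto
  then have cA: "card (A \<inter> ?W) = card {s. s < m * m \<and> l s \<in> A}"
    using assms(3) by (simp add: card_image inj_on_subset[of l "{..<m * m}"] subset_iff)
  have "{..<m * m} = {s. s < m * m \<and> l s \<in> A} \<union> {s. s < m * m \<and> l s \<notin> A}" by auto
  then have "m * m \<le> card {s. s < m * m \<and> l s \<in> A} + card {s. s < m * m \<and> l s \<notin> A}"
    by (metis card_Un_le card_lessThan)
  then show False using v cA bal mm unfolding A_def[symmetric] by (cases v) auto
qed

section \<open>Two slightly curved chains and two points\<close>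

lemma extreme_point_of_unique_min:
  assumes "finite S" "p \<in> S" "\<And>q. q \<in> S \<Longrightarrow> q \<noteq> p \<Longrightarrow> v \<bullet> p < v \<bullet> q"
  shows "p extreme_point_of (convex hull S)"
proof -
  \<comment> \<open>All other points lie in an open half-plane that excludes
    \<open>p\<close>.\<close>
  have "convex hull (S - {p}) \<subseteq> {q. v \<bullet> q > v \<bullet> p}"
    by (rule hull_minimal) (use assms(3) in \<open>auto simp: convex_halfspace_gt\<close>)
  then have "p \<notin> convex hull (S - {p})" by auto
  then have "p extreme_point_of (convex hull insert p (S - {p}))"
    using assms(1) by (intro extreme_point_of_convex_hull_insert) auto
  then show ?thesis using assms(2) by (simp add: insert_absorb)
qed

text \<open>The curvature \<open>d\<close> must be positive for strict convexity, but so small that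
  it does not affect orientations seen from \<open>px\<close> and \<open>py\<close>. Its effect on
  areas is cubic in the indices, hence the power of \<open>N\<close>.\<close>

locale two_chains =
  fixes m N :: nat and d :: real
  assumes m: "0 < m" "m \<le> N" and d: "0 < d" "d * N ^ 3 \<le> 1 / 16"
begin

definition low :: "nat \<Rightarrow> real ^ 2" where "low s = vector [real s, d * (real s)\<^sup>2]"
text \<open>For \<open>d = 0\<close>, the line from \<open>px\<close> to \<open>upp t\<close>
  crosses the lower chain at \<open>t + 1/2\<close>, and the line from \<open>py\<close> to
  \<open>upp t\<close> crosses it at \<open>t + m + 1/2\<close>. This is the reason for the factor 2
  and the summand 1.\<close>

definition upp :: "nat \<Rightarrow> real ^ 2" where "upp s = vector [2 * real s + 1, 1 - d * (real s)\<^sup>2]"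
definition px :: "real ^ 2" where "px = vector [0, -1]"
definition py :: "real ^ 2" where "py = vector [2 * real m, -1]"

lemmas coords = low_def upp_def px_def py_def vector_2

lemma small3: "d * (a * b * c) \<le> 1 / 16" if "0 \<le> a" "a \<le> N" "0 \<le> b" "b \<le> N" "0 \<le> c" "c \<le> N" for a b c :: real
proof -
  have "a * b * c \<le> real N * N * N" using that by (intro mult_mono) auto
  then have "d * (a * b * c) \<le> d * (real N * N * N)" using d by (intro mult_left_mono) auto
  also have "\<dots> \<le> 1 / 16" using d by (simp add: power3_eq_cube)
  finally show ?thesis .
qed

lemma small2: "d * (a * b) \<le> 1 / 16" if "0 \<le> a" "a \<le> N" "0 \<le> b" "b \<le> N" for a b :: real
  using small3[of a b 1] that m by simp

lemma ccw_px_low_low: "ccw_triangle px (low s) (low t) \<longleftrightarrow> t < s" if "s < N" "t < N" for s t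
proof -
  have "area2 px (low s) (low t) = (real s - real t) * (1 - d * (real s * real t))"
    by (simp add: area2_def coords power2_eq_square algebra_simps)
  moreover have "1 - d * (real s * real t) > 0" using small2[of s t] that by simp
  ultimately show ?thesis by (simp add: ccw_area2 zero_less_mult_iff)
qed

lemma area2_px: "area2 px (low s) (upp t) =
  2 * real s - 2 * real t - 1 - d * (real s * real t * real t) - 2 * (d * (real t * real s * real s)) - d * (real s * real s)"
  by (simp add: area2_def coords power2_eq_square algebra_simps)

text \<open>The main term \<open>2 * s - 2 * t - 1\<close> is an odd integer, whereas the terms with
  \<open>d\<close> sum to at most 1/4 in absolute value.\<close>

lemma area2_px_ge: "t < s \<Longrightarrow> area2 px (low s) (upp t) > 0"
  and area2_px_le: "s \<le> t \<Longrightarrow> area2 px (low s) (upp t) < 0" if "s < N" "t < N" for s t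
proof -
  note b = small3[of s t t] small3[of t s s] small2[of s s]
  have p: "0 \<le> d * (real s * real t * real t)" "0 \<le> d * (real t * real s * real s)" "0 \<le> d * (real s * real s)"
    using d by auto
  show "area2 px (low s) (upp t) > 0" if "t < s"
  proof -
    have "real t + 1 \<le> real s" using that by simp
    then show ?thesis unfolding area2_px using b \<open>s < N\<close> \<open>t < N\<close> by simp
  qed
  show "area2 px (low s) (upp t) < 0" if "s \<le> t"
  proof -
    have "real s \<le> real t" using that by simp
    then show ?thesis unfolding area2_px using p by linarith
  qed
qed

lemma area2_py: "area2 py (low s) (upp t) =
  2 * real s - 2 * real t - 2 * real m - 1 - d * (real s * real t * real t) + 2 * (d * (real m * real t * real t))
   - 2 * (d * (real t * real s * real s)) - d * (real s * real s) + 2 * (d * (real m * real s * real s))"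
  by (simp add: area2_def coords power2_eq_square algebra_simps)

text \<open>Again the main term is odd, now shifted by \<open>2 * m\<close>. The terms with
  \<open>d\<close> have both signs, and those of each sign contribute at most 1/4.\<close>

lemma area2_py_ge: "t + m < s \<Longrightarrow> area2 py (low s) (upp t) > 0"
  and area2_py_le: "s \<le> t + m \<Longrightarrow> area2 py (low s) (upp t) < 0" if "s < N" "t < N" for s t
proof -
  note b = small3[of s t t] small3[of t s s] small2[of s s] small3[of m t t] small3[of m s s]
  have p: "0 \<le> d * (real s * real t * real t)" "0 \<le> d * (real t * real s * real s)" "0 \<le> d * (real s * real s)"
    "0 \<le> d * (real m * real t * real t)" "0 \<le> d * (real m * real s * real s)"
    using d by auto
  show "area2 py (low s) (upp t) > 0" if "t + m < s"
  proof -
    have "real t + real m + 1 \<le> real s" using that by linarith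
    then show ?thesis unfolding area2_py using b p m \<open>s < N\<close> \<open>t < N\<close> by simp
  qed
  show "area2 py (low s) (upp t) < 0" if "s \<le> t + m"
  proof -
    have "real s \<le> real t + real m" using that by linarith
    then show ?thesis unfolding area2_py using b p m \<open>s < N\<close> \<open>t < N\<close> by simp
  qed
qed

lemma ccw_low_upp:
  assumes "s < N" "t < N"
  shows "ccw_triangle px (low s) (upp t) \<longleftrightarrow> t < s" "ccw_triangle px (upp t) (low s) \<longleftrightarrow> s \<le> t"
    "ccw_triangle py (low s) (upp t) \<longleftrightarrow> t + m < s" "ccw_triangle py (upp t) (low s) \<longleftrightarrow> s \<le> t + m"
proof -
  have swap: "area2 z (upp t) (low s) = - area2 z (low s) (upp t)" for z
    by (simp add: area2_def algebra_simps)
  show "ccw_triangle px (low s) (upp t) \<longleftrightarrow> t < s" "ccw_triangle px (upp t) (low s) \<longleftrightarrow> s \<le> t"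
    using area2_px_ge[OF assms] area2_px_le[OF assms] unfolding ccw_area2 swap by force+
  show "ccw_triangle py (low s) (upp t) \<longleftrightarrow> t + m < s" "ccw_triangle py (upp t) (low s) \<longleftrightarrow> s \<le> t + m"
    using area2_py_ge[OF assms] area2_py_le[OF assms] unfolding ccw_area2 swap by force+
qed

lemma low_inj: "low s = low t \<longleftrightarrow> s = t"
  by (auto simp: low_def vec_eq_iff forall_2)

lemma low_2_le: "low s $ 2 \<le> 1 / 16" if "s < N" for s
  using small2[of s s] that by (simp add: low_def power2_eq_square)

lemma upp_2_ge: "upp s $ 2 \<ge> 15 / 16" if "s < N" for s
  using small2[of s s] that by (simp add: upp_def power2_eq_square)

lemma low_neq_upp: "low s \<noteq> upp t" if "s < N" "t < N" for s t
  using low_2_le[OF that(1)] upp_2_ge[OF that(2)] by auto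

lemma pxy_neq: "s < N \<Longrightarrow> low s \<noteq> px" "s < N \<Longrightarrow> low s \<noteq> py" "s < N \<Longrightarrow> upp s \<noteq> px" "s < N \<Longrightarrow> upp s \<noteq> py" "px \<noteq> py"
proof -
  have "low s $ 2 \<ge> 0" using d by (simp add: low_def)
  then show "low s \<noteq> px" "low s \<noteq> py" by (auto simp: px_def py_def)
  show "s < N \<Longrightarrow> upp s \<noteq> px" "s < N \<Longrightarrow> upp s \<noteq> py" using upp_2_ge[of s] by (auto simp: px_def py_def)
  show "px \<noteq> py" using m by (simp add: px_def py_def vec_eq_iff forall_2)
qed

definition chain_points :: "(real ^ 2) set" where "chain_points = low ` {..<N} \<union> upp ` {..<N}"

lemma inner_vector_2: "vector [a, b] \<bullet> (q :: real ^ 2) = a * q $ 1 + b * q $ 2"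
  by (simp add: inner_vec_def sum_2)

text \<open>The supporting line in a point of a parabola is the tangent.\<close>

lemma strictly_convex_chains: "strictly_convex_position chain_points"
  unfolding strictly_convex_position_def
proof
  have fin: "finite chain_points" by (simp add: chain_points_def)
  fix p assume p: "p \<in> chain_points"
  then consider s where "s < N" "p = low s" | s where "s < N" "p = upp s" by (auto simp: chain_points_def)
  then show "p extreme_point_of (convex hull chain_points)"
  proof cases
    case 1
    show ?thesis
    \<comment> \<open>The upward normal of the tangent, whose slope is \<open>2 * d * s\<close>. The
      upper chain is higher by almost 1, which outweighs the terms with \<open>d\<close>.\<close>
    proof (rule extreme_point_of_unique_min[OF fin p, of "vector [- (2 * d * real s), 1]"])
      fix q assume q: "q \<in> chain_points" "q \<noteq> p"
      then consider t where "t < N" "q = low t" "t \<noteq> s" | t where "t < N" "q = upp t"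
        using 1 by (auto simp: chain_points_def)
      then show "vector [- (2 * d * real s), 1] \<bullet> p < vector [- (2 * d * real s), 1] \<bullet> q"
      proof cases
        case (1 t)
        have "0 < d * (real t - real s)\<^sup>2" using d 1 by simp
        then show ?thesis using 1 \<open>p = low s\<close>
          by (simp add: inner_vector_2 low_def power2_eq_square algebra_simps)
      next
        case (2 t)
        have "0 \<le> d * (real s * real s)" using d by simp
        then show ?thesis using 2 \<open>p = low s\<close> \<open>s < N\<close> small2[of s s] small2[of t t] small2[of s t] small2[of s 1] m
          by (simp add: inner_vector_2 low_def upp_def power2_eq_square algebra_simps)
      qed
    qed
  next
    case 2
    show ?thesis
    \<comment> \<open>The abscissa is \<open>2 * s + 1\<close>, so the upper chain has slope
      \<open>- d * s\<close> here, and this is its downward normal.\<close>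
    proof (rule extreme_point_of_unique_min[OF fin p, of "vector [- (d * real s), - 1]"])
      fix q assume q: "q \<in> chain_points" "q \<noteq> p"
      then consider t where "t < N" "q = upp t" "t \<noteq> s" | t where "t < N" "q = low t"
        using 2 by (auto simp: chain_points_def)
      then show "vector [- (d * real s), - 1] \<bullet> p < vector [- (d * real s), - 1] \<bullet> q"
      proof cases
        case (1 t)
        have "0 < d * (real t - real s)\<^sup>2" using d 1 by simp
        then show ?thesis using 1 \<open>p = upp s\<close>
          by (simp add: inner_vector_2 upp_def power2_eq_square algebra_simps)
      next
        case (2 t)
        have "0 \<le> d * (real s * real s)" "0 \<le> d * real s" using d by auto
        then show ?thesis using 2 \<open>p = upp s\<close> \<open>s < N\<close> small2[of t t] small2[of s t] 
          by (simp add: inner_vector_2 low_def upp_def power2_eq_square algebra_simps)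
      qed
    qed
  qed
qed

end

lemma clique_width_convex_and_two_points_unbounded:
  "\<exists>P P0 :: (real ^ 2) set. finite P \<and> P0 \<subseteq> P \<and> strictly_convex_position P0 \<and> card (P - P0) = 2
    \<and> clique_width P > enat n"
proof -
  define m where "m = 5 * 2 ^ n + (1 :: nat)"
  define N where "N = m * m"
  have "0 < m" by (simp add: m_def)
  then have "0 < N" by (simp add: N_def)
  \<comment> \<open>The largest curvature that the locale admits.\<close>
  define d where "d = 1 / (16 * real N ^ 3)"
  interpret two_chains m N d
    by unfold_locales (use \<open>0 < m\<close> \<open>0 < N\<close> in \<open>simp_all add: d_def, simp add: N_def\<close>)
  define P where "P = insert px (insert py chain_points)"
  have notin: "px \<notin> chain_points" "py \<notin> chain_points" by (auto simp: chain_points_def pxy_neq(1-4)[symmetric])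
  have fin: "finite P" by (simp add: P_def chain_points_def)
  have sub: "low ` {..<N} \<subseteq> P" by (auto simp: P_def chain_points_def)
  have "P - chain_points = {px, py}" using notin by (auto simp: P_def)
  then have card: "card (P - chain_points) = 2" using pxy_neq(5) by simp
  have R: "(z, low s, low t) \<in> order_type P \<longleftrightarrow> s \<noteq> t \<and> ccw_triangle z (low s) (low t)"
    "(z, low s, upp t) \<in> order_type P \<longleftrightarrow> ccw_triangle z (low s) (upp t)"
    "(z, upp t, low s) \<in> order_type P \<longleftrightarrow> ccw_triangle z (upp t) (low s)"
    if "s < N" "t < N" "z = px \<or> z = py" for z s t
    using that pxy_neq(1-4)[of s] pxy_neq(1-4)[of t] low_neq_upp[OF that(1,2)]
    by (auto simp: order_type_def P_def chain_points_def low_inj)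
  have "n < width e" if e: "valid_expr e" "points e = P" "triples e = order_type P"
    for e :: "(real ^ 2, nat, nat) cw_expr"
  proof (rule width_shifted_orders[where x = px and y = py and l = low and u = upp, OF e(1)];
      (fold m_def N_def)?)
    show "inj_on low {..<N}" by (auto simp: inj_on_def low_inj)
    show "low ` {..<N} \<subseteq> points e" using sub e(2) by simp
  qed (use pxy_neq in \<open>auto simp: e(3) R ccw_px_low_low ccw_low_upp\<close>)
  \<comment> \<open>The bound holds for each expression, so it passes to the infimum.\<close>
  then have "enat (Suc n) \<le> structure_clique_width P (order_type P)"
    unfolding structure_clique_width_def using \<open>P - chain_points = {px, py}\<close>
    by (auto intro!: INF_greatest simp: Suc_le_eq)
  then have "clique_width P > enat n"
    unfolding clique_width_def by (meson enat_ord_simps(2) lessI less_le_trans)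
  then show ?thesis using fin card strictly_convex_chains by (intro exI[of _ P] exI[of _ chain_points]) (auto simp: P_def)
qed

theorem theorem3:
  shows
    "(\<exists>C::nat. \<forall>P P0 :: (real ^ 2) set.
        finite P \<and> P0 \<subseteq> P \<and> collinear P0
        \<longrightarrow> clique_width P \<le> enat (C * (card (P - P0) + 1)))
     \<and> (\<exists>C'::nat. \<forall>P P0 :: (real ^ 2) set.
        finite P \<and> P0 \<subseteq> P \<and> strictly_convex_position P0 \<and> card (P - P0) \<le> 1
        \<longrightarrow> clique_width P \<le> enat C')
     \<and> (\<forall>n::nat. \<exists>P P0 :: (real ^ 2) set.
        finite P \<and> P0 \<subseteq> P \<and> strictly_convex_position P0 \<and> card (P - P0) = 2
        \<and> clique_width P > enat n)"
  using clique_width_collinear clique_width_convex clique_width_convex_and_two_points_unbounded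
  by blast

end
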